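(* (1) Let $(V,\mu,\nu)$ be a right-unital associative algebra in a strict monoidal category $(\mathcal C,\otimes,\mathbf I)$. (a) The morphism $\sigma_{Ass}:=\nu\otimes\mu:V\otimes V=\mathbf I\otimes V\otimes V\to V\otimes V$ is a pre-braiding on $V$. (b) If $\nu$ is moreover a two-sided unit, then the comultiplication $\Delta_{Ass}:=\nu\otimes\mathrm{Id}_V:V=\mathbf I\otimes V\to V\otimes V$ makes $(V,\sigma_{Ass},\Delta_{Ass})$ a $\sigma_{Ass}$-cocommutative pre-braided coalgebra. (c) Any algebra character $\epsilon:V\to\mathbf I$ is a braided character for $(V,\sigma_{Ass})$. (d) $\sigma_{Ass}$ is demi-natural with respect to $\nu$. Moreover, for any algebra character $\epsilon$, the pair $(\nu,\epsilon)$ is normalized. (2) Let $(V,[,],\nu)$ be a unital Leibniz algebra in a symmetric preadditive strict monoidal category $(\mathcal C,\otimes,\mathbf I,c)$. (a) The morphism $\sigma_{Lei}:=c_{V,V}+\nu\otimes[,]:V\otimes V\to V\otimes V$ is an invertible pre-braiding on $V$. (b) If $\mathcal C$ is additive and one has a Leibniz algebra decomposition $V\simeq V'\oplus\mathbf I$, then the comultiplication $\Delta_{Lei}$ given by $\Delta_{Lei}|_{V'}:=\nu\otimes\mathrm{Id}_{V'}+\mathrm{Id}_{V'}\otimes\nu:V'\to V\otimes V$ and $\Delta_{Lei}|_{\mathbf I}:=\nu\otimes\nu:\mathbf I\to V\otimes V$ makes $(V,\sigma_{Lei},\Delta_{Lei})$ a $\sigma_{Lei}$-cocommutative semi-pre-braided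 coalgebra. (c) Any Lie character $\epsilon:V\to\mathbf I$ is a braided character for $(V,\sigma_{Lei})$. (d) $\sigma_{Lei}$ is natural with respect to $\nu$. Moreover, for any Lie character $\epsilon$, the pair $(\nu,\epsilon)$ is normalized.
   Context: In a preadditive monoidal category, $\otimes$ is additive in each variable. For $\varphi:V^{\otimes l}\to V^{\otimes r}$, $\varphi_i=\mathrm{Id}_{V^{\otimes(i-1)}}\otimes\varphi\otimes\mathrm{Id}$. A pre-braiding on an object $V$ is a morphism $\sigma:V\otimes V\to V\otimes V$ with $\sigma_1\sigma_2\sigma_1=\sigma_2\sigma_1\sigma_2$ on $V^{\otimes 3}$. A braided character for $(V,\sigma)$ is $\epsilon:V\to\mathbf I$ with $(\epsilon\otimes\epsilon)\circ\sigma=\epsilon\otimes\epsilon$. $(V,\sigma,\Delta)$ with $\Delta:V\to V\otimes V$ is a pre-braided coalgebra if $\Delta$ is coassociative, $\Delta_2\sigma=\sigma_1\sigma_2\Delta_1$ and $\Delta_1\sigma=\sigma_2\sigma_1\Delta_2$; semi-pre-braided if $\Delta$ is coassociative and only $\Delta_2\sigma=\sigma_1\sigma_2\Delta_1$ is required; $\sigma$-cocommutative if $\sigma\Delta=\Delta$. For $\eta:\mathbf I\to V$, $\psi:V\to\mathbf I$: $(\eta,\psi)$ is normalized if $\psi\circ\eta=\mathrm{Id}_{\mathbf I}$; $\sigma$ is demi-natural with respect to $\eta$ if $\sigma\circ(\mathrm{Id}_V\otimes\eta)=\eta\otimes\mathrm{Id}_V$, and natural with respect to $\eta$ if in addition $\sigma\circ(\eta\otimes\mathrm{Id}_V)=\mathrm{Id}_V\otimes\eta$.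 A right-unital associative algebra in $\mathcal C$ is an object $V$ with $\mu:V\otimes V\to V$, $\nu:\mathbf I\to V$ such that $\mu(\mathrm{Id}\otimes\mu)=\mu(\mu\otimes\mathrm{Id})$ and $\mu(\mathrm{Id}_V\otimes\nu)=\mathrm{Id}_V$; $\nu$ is two-sided if also $\mu(\nu\otimes\mathrm{Id}_V)=\mathrm{Id}_V$. An algebra character is a morphism $\epsilon:V\to\mathbf I$ with $\epsilon\circ\mu=\epsilon\otimes\epsilon$ and $\epsilon\circ\nu=\mathrm{Id}_{\mathbf I}$. A unital Leibniz algebra in a symmetric preadditive category (with symmetric braiding $c$) is an object $V$ with $[,]:V\otimes V\to V$, $\nu:\mathbf I\to V$ such that $[,]\circ(\mathrm{Id}_V\otimes[,])=[,]\circ([,]\otimes\mathrm{Id}_V)-[,]\circ([,]\otimes\mathrm{Id}_V)\circ(\mathrm{Id}_V\otimes c_{V,V})$ and $[,]\circ(\mathrm{Id}_V\otimes\nu)=[,]\circ(\nu\otimes\mathrm{Id}_V)=0$. A Lie character is $\epsilon:V\to\mathbf I$ with $\epsilon\circ[,]=0$ and $\epsilon\circ\nu=\mathrm{Id}_{\mathbf I}$. A Leibniz algebra decomposition $V\simeq V'\oplus\mathbf I$ means a biproduct decomposition in which $\nu$ is the inclusion of the summand $\mathbf I$ and the bracket of $V$ restricts on $V'\otimes V'$ to a Leibniz bracket with values in $V'$. *)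

theory Defs
  imports "HOL-Algebra.Group"
begin

text \<open>
  A category is given by a set of objects and a set of arrows, each arrow with one source and one
  target. Composition is written in the usual order: in \<open>g \<cdot> f\<close> the arrow \<open>f\<close> is applied first.
  Because arrows of all hom-sets share one type, the strictness equations can be stated as
  plain equalities of objects and arrows.
\<close>

record ('o, 'm) category =
  obj :: "'o set"
  arr :: "'m set"
  src :: "'m \<Rightarrow> 'o"
  trg :: "'m \<Rightarrow> 'o"
  idm :: "'o \<Rightarrow> 'm" ("Id\<index>")
  cmp :: "'m \<Rightarrow> 'm \<Rightarrow> 'm" (infixr "\<cdot>\<index>" 70)

definition mor :: "('o, 'm, 'x) category_scheme \<Rightarrow> 'o \<Rightarrow> 'o \<Rightarrow> 'm set" where
  "mor C A B = {f \<in> arr C. src C f = A \<and> trg C f = B}"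

locale category =
  fixes C :: "('o, 'm, 'x) category_scheme" (structure)
  assumes src_obj: "f \<in> arr C \<Longrightarrow> src C f \<in> obj C"
    and trg_obj: "f \<in> arr C \<Longrightarrow> trg C f \<in> obj C"
    and id_mor: "A \<in> obj C \<Longrightarrow> Id A \<in> mor C A A"
    and comp_mor: "f \<in> mor C A B \<Longrightarrow> g \<in> mor C B D \<Longrightarrow> g \<cdot> f \<in> mor C A D"
    and comp_id_left: "f \<in> mor C A B \<Longrightarrow> Id B \<cdot> f = f"
    and comp_id_right: "f \<in> mor C A B \<Longrightarrow> f \<cdot> Id A = f"
    and comp_assoc: "f \<in> mor C A B \<Longrightarrow> g \<in> mor C B D \<Longrightarrow> h \<in> mor C D E \<Longrightarrow>
      (h \<cdot> g) \<cdot> f = h \<cdot> (g \<cdot> f)"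

definition (in category) invertible :: "'o \<Rightarrow> 'o \<Rightarrow> 'm \<Rightarrow> bool" where
  "invertible A B f \<longleftrightarrow> f \<in> mor C A B \<and>
     (\<exists>g \<in> mor C B A. g \<cdot> f = Id A \<and> f \<cdot> g = Id B)"

record ('o, 'm) monoidal_category = "('o, 'm) category" +
  tens_obj :: "'o \<Rightarrow> 'o \<Rightarrow> 'o" (infixr "\<otimes>\<^sub>o\<index>" 75)
  tens_mor :: "'m \<Rightarrow> 'm \<Rightarrow> 'm" (infixr "\<otimes>\<^sub>m\<index>" 75)
  unit_obj :: "'o" ("\<I>\<index>")

locale strict_monoidal_category = category C
  for C :: "('o, 'm, 'x) monoidal_category_scheme" (structure) +
  assumes unit_obj: "\<I> \<in> obj C"
    and tens_obj: "A \<in> obj C \<Longrightarrow> B \<in> obj C \<Longrightarrow> A \<otimes>\<^sub>o B \<in> obj C"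
    and tens_mor: "f \<in> mor C A B \<Longrightarrow> g \<in> mor C A' B' \<Longrightarrow>
      f \<otimes>\<^sub>m g \<in> mor C (A \<otimes>\<^sub>o A') (B \<otimes>\<^sub>o B')"
    and tens_id: "A \<in> obj C \<Longrightarrow> B \<in> obj C \<Longrightarrow> Id A \<otimes>\<^sub>m Id B = Id (A \<otimes>\<^sub>o B)"
    and tens_comp: "f \<in> mor C A B \<Longrightarrow> g \<in> mor C B D \<Longrightarrow>
      f' \<in> mor C A' B' \<Longrightarrow> g' \<in> mor C B' D' \<Longrightarrow>
      (g \<cdot> f) \<otimes>\<^sub>m (g' \<cdot> f') = (g \<otimes>\<^sub>m g') \<cdot> (f \<otimes>\<^sub>m f')"
    and tens_obj_assoc: "A \<in> obj C \<Longrightarrow> B \<in> obj C \<Longrightarrow> D \<in> obj C \<Longrightarrow>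
      (A \<otimes>\<^sub>o B) \<otimes>\<^sub>o D = A \<otimes>\<^sub>o (B \<otimes>\<^sub>o D)"
    and tens_obj_unit_left: "A \<in> obj C \<Longrightarrow> \<I> \<otimes>\<^sub>o A = A"
    and tens_obj_unit_right: "A \<in> obj C \<Longrightarrow> A \<otimes>\<^sub>o \<I> = A"
    and tens_mor_assoc: "f \<in> arr C \<Longrightarrow> g \<in> arr C \<Longrightarrow> h \<in> arr C \<Longrightarrow>
      (f \<otimes>\<^sub>m g) \<otimes>\<^sub>m h = f \<otimes>\<^sub>m (g \<otimes>\<^sub>m h)"
    and tens_mor_unit_left: "f \<in> arr C \<Longrightarrow> Id \<I> \<otimes>\<^sub>m f = f"
    and tens_mor_unit_right: "f \<in> arr C \<Longrightarrow> f \<otimes>\<^sub>m Id \<I> = f"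
begin

primrec tens_pow :: "'o \<Rightarrow> nat \<Rightarrow> 'o" where
  "tens_pow V 0 = \<I>"
| "tens_pow V (Suc n) = V \<otimes>\<^sub>o tens_pow V n"

text \<open>
  \<open>strand V i \<phi> q\<close> is the morphism \<open>\<phi>\<close> placed at position \<open>i \<ge> 1\<close> of a tensor power of \<open>V\<close>,
  followed by \<open>q\<close> identity strands; the informal notation \<open>\<phi>\<^sub>i\<close> leaves \<open>q\<close> implicit.
\<close>

definition strand :: "'o \<Rightarrow> nat \<Rightarrow> 'm \<Rightarrow> nat \<Rightarrow> 'm" where
  "strand V i \<phi> q = Id (tens_pow V (i - 1)) \<otimes>\<^sub>m \<phi> \<otimes>\<^sub>m Id (tens_pow V q)"

end

text \<open>The second hexagon identity follows from the first one and symmetry.\<close>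

locale symmetric_strict_monoidal_category = strict_monoidal_category C
  for C :: "('o, 'm, 'x) monoidal_category_scheme" (structure) +
  fixes c :: "'o \<Rightarrow> 'o \<Rightarrow> 'm"
  assumes braid_mor: "A \<in> obj C \<Longrightarrow> B \<in> obj C \<Longrightarrow> c A B \<in> mor C (A \<otimes>\<^sub>o B) (B \<otimes>\<^sub>o A)"
    and braid_natural: "f \<in> mor C A A' \<Longrightarrow> g \<in> mor C B B' \<Longrightarrow>
      c A' B' \<cdot> (f \<otimes>\<^sub>m g) = (g \<otimes>\<^sub>m f) \<cdot> c A B"
    and braid_hexagon: "A \<in> obj C \<Longrightarrow> B \<in> obj C \<Longrightarrow> D \<in> obj C \<Longrightarrow>
      c A (B \<otimes>\<^sub>o D) = (Id B \<otimes>\<^sub>m c A D) \<cdot> (c A B \<otimes>\<^sub>m Id D)"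
    and braid_symmetric: "A \<in> obj C \<Longrightarrow> B \<in> obj C \<Longrightarrow> c B A \<cdot> c A B = Id (A \<otimes>\<^sub>o B)"

text \<open>
  Addition is a single operation on arrows; it is meaningful only for two arrows in the same
  hom-set. Neither \<open>preadditive_category\<close> nor \<open>additive_category\<close> refers to the monoidal
  structure, although the record carries it.
\<close>

record ('o, 'm) preadditive_monoidal_category = "('o, 'm) monoidal_category" +
  mzero :: "'o \<Rightarrow> 'o \<Rightarrow> 'm" ("\<zero>\<^sub>m\<index>")
  madd :: "'m \<Rightarrow> 'm \<Rightarrow> 'm" (infixl "+\<^sub>m\<index>" 65)

definition hom_group ::
  "('o, 'm, 'x) preadditive_monoidal_category_scheme \<Rightarrow> 'o \<Rightarrow> 'o \<Rightarrow> 'm monoid" where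
  "hom_group C A B = \<lparr>carrier = mor C A B, mult = madd C, one = mzero C A B\<rparr>"

definition msub ::
  "('o, 'm, 'x) preadditive_monoidal_category_scheme \<Rightarrow> 'm \<Rightarrow> 'm \<Rightarrow> 'm"
  (infixl "-\<^sub>m\<index>" 65) where
  "f -\<^sub>m\<^bsub>C\<^esub> g = f +\<^sub>m\<^bsub>C\<^esub> inv\<^bsub>hom_group C (src C g) (trg C g)\<^esub> g"

locale preadditive_category = category C
  for C :: "('o, 'm, 'x) preadditive_monoidal_category_scheme" (structure) +
  assumes hom_comm_group: "A \<in> obj C \<Longrightarrow> B \<in> obj C \<Longrightarrow> comm_group (hom_group C A B)"
    and comp_add_left: "f \<in> mor C A B \<Longrightarrow> g \<in> mor C B D \<Longrightarrow> g' \<in> mor C B D \<Longrightarrow>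
      (g +\<^sub>m g') \<cdot> f = g \<cdot> f +\<^sub>m g' \<cdot> f"
    and comp_add_right: "f \<in> mor C A B \<Longrightarrow> f' \<in> mor C A B \<Longrightarrow> g \<in> mor C B D \<Longrightarrow>
      g \<cdot> (f +\<^sub>m f') = g \<cdot> f +\<^sub>m g \<cdot> f'"
begin

definition zero_object :: "'o \<Rightarrow> bool" where
  "zero_object Z \<longleftrightarrow> Z \<in> obj C \<and>
     (\<forall>A \<in> obj C. (\<exists>!f. f \<in> mor C Z A) \<and> (\<exists>!f. f \<in> mor C A Z))"

definition biproduct :: "'o \<Rightarrow> 'o \<Rightarrow> 'o \<Rightarrow> 'm \<Rightarrow> 'm \<Rightarrow> 'm \<Rightarrow> 'm \<Rightarrow> bool" where
  "biproduct A B P i j p q \<longleftrightarrow>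
     A \<in> obj C \<and> B \<in> obj C \<and> P \<in> obj C \<and>
     i \<in> mor C A P \<and> j \<in> mor C B P \<and> p \<in> mor C P A \<and> q \<in> mor C P B \<and>
     p \<cdot> i = Id A \<and> q \<cdot> j = Id B \<and> p \<cdot> j = \<zero>\<^sub>m B A \<and> q \<cdot> i = \<zero>\<^sub>m A B \<and>
     i \<cdot> p +\<^sub>m j \<cdot> q = Id P"

end

locale additive_category = preadditive_category C
  for C :: "('o, 'm, 'x) preadditive_monoidal_category_scheme" (structure) +
  assumes ex_zero_object: "\<exists>Z. zero_object Z"
    and ex_biproduct: "A \<in> obj C \<Longrightarrow> B \<in> obj C \<Longrightarrow> \<exists>P i j p q. biproduct A B P i j p q"

locale preadditive_strict_monoidal_category =
  strict_monoidal_category C + preadditive_category C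
  for C :: "('o, 'm, 'x) preadditive_monoidal_category_scheme" (structure) +
  assumes tens_add_left: "f \<in> mor C A B \<Longrightarrow> f' \<in> mor C A B \<Longrightarrow> g \<in> mor C A' B' \<Longrightarrow>
      (f +\<^sub>m f') \<otimes>\<^sub>m g = f \<otimes>\<^sub>m g +\<^sub>m f' \<otimes>\<^sub>m g"
    and tens_add_right: "f \<in> mor C A B \<Longrightarrow> g \<in> mor C A' B' \<Longrightarrow> g' \<in> mor C A' B' \<Longrightarrow>
      f \<otimes>\<^sub>m (g +\<^sub>m g') = f \<otimes>\<^sub>m g +\<^sub>m f \<otimes>\<^sub>m g'"

locale symmetric_preadditive_strict_monoidal_category =
  symmetric_strict_monoidal_category C c + preadditive_strict_monoidal_category C
  for C :: "('o, 'm, 'x) preadditive_monoidal_category_scheme" (structure) and c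

locale pre_braided_object = strict_monoidal_category C
  for C :: "('o, 'm, 'x) monoidal_category_scheme" (structure) +
  fixes V :: 'o and \<sigma> :: 'm
  assumes V_obj: "V \<in> obj C"
    and sigma_mor: "\<sigma> \<in> mor C (V \<otimes>\<^sub>o V) (V \<otimes>\<^sub>o V)"
    and yang_baxter:
      "strand V 1 \<sigma> 1 \<cdot> strand V 2 \<sigma> 0 \<cdot> strand V 1 \<sigma> 1 =
       strand V 2 \<sigma> 0 \<cdot> strand V 1 \<sigma> 1 \<cdot> strand V 2 \<sigma> 0"

locale braided_character = pre_braided_object C V \<sigma>
  for C :: "('o, 'm, 'x) monoidal_category_scheme" (structure) and V \<sigma> +
  fixes \<epsilon> :: 'm
  assumes char_mor: "\<epsilon> \<in> mor C V \<I>"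
    and char_braided: "(\<epsilon> \<otimes>\<^sub>m \<epsilon>) \<cdot> \<sigma> = \<epsilon> \<otimes>\<^sub>m \<epsilon>"

locale semi_pre_braided_coalgebra = pre_braided_object C V \<sigma>
  for C :: "('o, 'm, 'x) monoidal_category_scheme" (structure) and V \<sigma> +
  fixes \<Delta> :: 'm
  assumes comult_mor: "\<Delta> \<in> mor C V (V \<otimes>\<^sub>o V)"
    and coassociative: "strand V 1 \<Delta> 1 \<cdot> \<Delta> = strand V 2 \<Delta> 0 \<cdot> \<Delta>"
    and comult_compat:
      "strand V 2 \<Delta> 0 \<cdot> \<sigma> = strand V 1 \<sigma> 1 \<cdot> strand V 2 \<sigma> 0 \<cdot> strand V 1 \<Delta> 1"

locale pre_braided_coalgebra = semi_pre_braided_coalgebra C V \<sigma> \<Delta>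
  for C :: "('o, 'm, 'x) monoidal_category_scheme" (structure) and V \<sigma> \<Delta> +
  assumes comult_compat':
      "strand V 1 \<Delta> 1 \<cdot> \<sigma> = strand V 2 \<sigma> 0 \<cdot> strand V 1 \<sigma> 1 \<cdot> strand V 2 \<Delta> 0"

definition cocommutative :: "('o, 'm, 'x) category_scheme \<Rightarrow> 'm \<Rightarrow> 'm \<Rightarrow> bool" where
  "cocommutative C \<sigma> \<Delta> \<longleftrightarrow> \<sigma> \<cdot>\<^bsub>C\<^esub> \<Delta> = \<Delta>"

definition normalized_pair ::
  "('o, 'm, 'x) monoidal_category_scheme \<Rightarrow> 'o \<Rightarrow> 'm \<Rightarrow> 'm \<Rightarrow> bool" where
  "normalized_pair C V \<eta> \<psi> \<longleftrightarrow>
     \<eta> \<in> mor C \<I>\<^bsub>C\<^esub> V \<and> \<psi> \<in> mor C V \<I>\<^bsub>C\<^esub> \<and> \<psi> \<cdot>\<^bsub>C\<^esub> \<eta> = Id\<^bsub>C\<^esub> \<I>\<^bsub>C\<^esub>"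

definition demi_natural ::
  "('o, 'm, 'x) monoidal_category_scheme \<Rightarrow> 'o \<Rightarrow> 'm \<Rightarrow> 'm \<Rightarrow> bool" where
  "demi_natural C V \<sigma> \<eta> \<longleftrightarrow>
     \<eta> \<in> mor C \<I>\<^bsub>C\<^esub> V \<and> \<sigma> \<cdot>\<^bsub>C\<^esub> (Id\<^bsub>C\<^esub> V \<otimes>\<^sub>m\<^bsub>C\<^esub> \<eta>) = \<eta> \<otimes>\<^sub>m\<^bsub>C\<^esub> Id\<^bsub>C\<^esub> V"

definition natural_wrt ::
  "('o, 'm, 'x) monoidal_category_scheme \<Rightarrow> 'o \<Rightarrow> 'm \<Rightarrow> 'm \<Rightarrow> bool" where
  "natural_wrt C V \<sigma> \<eta> \<longleftrightarrow>
     demi_natural C V \<sigma> \<eta> \<and> \<sigma> \<cdot>\<^bsub>C\<^esub> (\<eta> \<otimes>\<^sub>m\<^bsub>C\<^esub> Id\<^bsub>C\<^esub> V) = Id\<^bsub>C\<^esub> V \<otimes>\<^sub>m\<^bsub>C\<^esub> \<eta>"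

locale right_unital_algebra = strict_monoidal_category C
  for C :: "('o, 'm, 'x) monoidal_category_scheme" (structure) +
  fixes V :: 'o and \<mu> \<nu> :: 'm
  assumes V_obj: "V \<in> obj C"
    and mult_mor: "\<mu> \<in> mor C (V \<otimes>\<^sub>o V) V"
    and unit_mor: "\<nu> \<in> mor C \<I> V"
    and mult_assoc: "\<mu> \<cdot> (Id V \<otimes>\<^sub>m \<mu>) = \<mu> \<cdot> (\<mu> \<otimes>\<^sub>m Id V)"
    and mult_unit_right: "\<mu> \<cdot> (Id V \<otimes>\<^sub>m \<nu>) = Id V"

locale unital_algebra = right_unital_algebra C V \<mu> \<nu>
  for C :: "('o, 'm, 'x) monoidal_category_scheme" (structure) and V \<mu> \<nu> +
  assumes mult_unit_left: "\<mu> \<cdot> (\<nu> \<otimes>\<^sub>m Id V) = Id V"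

locale algebra_character = right_unital_algebra C V \<mu> \<nu>
  for C :: "('o, 'm, 'x) monoidal_category_scheme" (structure) and V \<mu> \<nu> +
  fixes \<epsilon> :: 'm
  assumes char_mor: "\<epsilon> \<in> mor C V \<I>"
    and char_mult: "\<epsilon> \<cdot> \<mu> = \<epsilon> \<otimes>\<^sub>m \<epsilon>"
    and char_unit: "\<epsilon> \<cdot> \<nu> = Id \<I>"

definition sigma_Ass :: "('o, 'm, 'x) monoidal_category_scheme \<Rightarrow> 'm \<Rightarrow> 'm \<Rightarrow> 'm" where
  "sigma_Ass C \<mu> \<nu> = \<nu> \<otimes>\<^sub>m\<^bsub>C\<^esub> \<mu>"

definition Delta_Ass :: "('o, 'm, 'x) monoidal_category_scheme \<Rightarrow> 'o \<Rightarrow> 'm \<Rightarrow> 'm" where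
  "Delta_Ass C V \<nu> = \<nu> \<otimes>\<^sub>m\<^bsub>C\<^esub> Id\<^bsub>C\<^esub> V"

locale leibniz_algebra = symmetric_preadditive_strict_monoidal_category C c
  for C :: "('o, 'm, 'x) preadditive_monoidal_category_scheme" (structure) and c +
  fixes V :: 'o and \<beta> :: 'm
  assumes V_obj: "V \<in> obj C"
    and bracket_mor: "\<beta> \<in> mor C (V \<otimes>\<^sub>o V) V"
    and leibniz: "\<beta> \<cdot> (Id V \<otimes>\<^sub>m \<beta>) =
      \<beta> \<cdot> (\<beta> \<otimes>\<^sub>m Id V) -\<^sub>m \<beta> \<cdot> (\<beta> \<otimes>\<^sub>m Id V) \<cdot> (Id V \<otimes>\<^sub>m c V V)"

locale unital_leibniz_algebra = leibniz_algebra C c V \<beta>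
  for C :: "('o, 'm, 'x) preadditive_monoidal_category_scheme" (structure) and c V \<beta> +
  fixes \<nu> :: 'm
  assumes unit_mor: "\<nu> \<in> mor C \<I> V"
    and bracket_unit_right: "\<beta> \<cdot> (Id V \<otimes>\<^sub>m \<nu>) = \<zero>\<^sub>m V V"
    and bracket_unit_left: "\<beta> \<cdot> (\<nu> \<otimes>\<^sub>m Id V) = \<zero>\<^sub>m V V"

locale lie_character = unital_leibniz_algebra C c V \<beta> \<nu>
  for C :: "('o, 'm, 'x) preadditive_monoidal_category_scheme" (structure) and c V \<beta> \<nu> +
  fixes \<epsilon> :: 'm
  assumes char_mor: "\<epsilon> \<in> mor C V \<I>"
    and char_bracket: "\<epsilon> \<cdot> \<beta> = \<zero>\<^sub>m (V \<otimes>\<^sub>o V) \<I>"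
    and char_unit: "\<epsilon> \<cdot> \<nu> = Id \<I>"

locale leibniz_decomposition = unital_leibniz_algebra C c V \<beta> \<nu>
  for C :: "('o, 'm, 'x) preadditive_monoidal_category_scheme" (structure) and c V \<beta> \<nu> +
  fixes V' :: 'o and i p q :: 'm
  assumes decomposition: "biproduct V' \<I> V i \<nu> p q"
    and bracket_restricts:
      "\<exists>\<beta>'. leibniz_algebra C c V' \<beta>' \<and> \<beta> \<cdot> (i \<otimes>\<^sub>m i) = i \<cdot> \<beta>'"

definition sigma_Lei ::
  "('o, 'm, 'x) preadditive_monoidal_category_scheme \<Rightarrow> ('o \<Rightarrow> 'o \<Rightarrow> 'm) \<Rightarrow>
   'o \<Rightarrow> 'm \<Rightarrow> 'm \<Rightarrow> 'm" where
  "sigma_Lei C c V \<beta> \<nu> = c V V +\<^sub>m\<^bsub>C\<^esub> \<nu> \<otimes>\<^sub>m\<^bsub>C\<^esub> \<beta>"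

text \<open>
  The comultiplication is prescribed by its restrictions to the two summands, restriction being
  composition with the inclusions \<open>i\<close> and \<open>\<nu>\<close>.  The maps \<open>\<nu> \<otimes> Id\<close> and \<open>Id \<otimes> \<nu>\<close> on \<open>V'\<close> land in
  \<open>V \<otimes> V\<close> only after including \<open>V'\<close> into \<open>V\<close>, hence \<open>i\<close> in place of \<open>Id\<close>.
\<close>

definition is_Delta_Lei ::
  "('o, 'm, 'x) preadditive_monoidal_category_scheme \<Rightarrow> 'o \<Rightarrow> 'm \<Rightarrow> 'm \<Rightarrow> 'm \<Rightarrow> bool" where
  "is_Delta_Lei C V \<nu> i \<Delta> \<longleftrightarrow>
     \<Delta> \<in> mor C V (V \<otimes>\<^sub>o\<^bsub>C\<^esub> V) \<and>
     \<Delta> \<cdot>\<^bsub>C\<^esub> i = \<nu> \<otimes>\<^sub>m\<^bsub>C\<^esub> i +\<^sub>m\<^bsub>C\<^esub> i \<otimes>\<^sub>m\<^bsub>C\<^esub> \<nu> \<and>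
     \<Delta> \<cdot>\<^bsub>C\<^esub> \<nu> = \<nu> \<otimes>\<^sub>m\<^bsub>C\<^esub> \<nu>"

end

theory Submission
  imports Defs
begin

text \<open>
  The idea is visible in element notation, with \<open>1\<close> for the unit and tuples for tensors. The
  braiding of an algebra is \<open>\<sigma> (a, b) = (1, a b)\<close>. Both sides of the Yang--Baxter equation collect
  all factors in the last strand: they send \<open>(a, b, c)\<close> to \<open>(1, 1, (a b) c)\<close> and
  \<open>(1, 1, a (b c))\<close>, so the equation is associativity, the right unit law being used to
  remove the units that appear on the way (\<open>pre_braided_Ass\<close>).

  The braiding of a Leibniz algebra is \<open>\<sigma> (a, b) = (b, a) + (1, [a, b])\<close>. Expanding the
  Yang--Baxter equation bilinearly, the terms with at most one bracket agree by naturality of the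
  symmetry. Among those with two or three brackets, the ones that bracket with \<open>1\<close> vanish, and what
  remains is \<open>[[a, b], c] = [a, [b, c]] + [[a, c], b]\<close> in the last strand, which is the Leibniz
  identity (\<open>yang_baxter_sum\<close>, \<open>pre_braided_Lei\<close>). The error term \<open>(1, [a, b])\<close> can be subtracted off
  again because \<open>\<sigma>\<close> merely exchanges \<open>1\<close> with other elements (\<open>invertible_Lei\<close>).

  For a decomposition with projection \<open>\<pi>\<close> of \<open>V\<close> onto \<open>V'\<close>, the comultiplication has
  the closed form \<open>\<Delta> a = (1, a) + (\<pi> a, 1)\<close> (\<open>is_Delta_Lei_iff\<close>), which avoids splitting
  \<open>V \<otimes> V\<close> into four summands. The coalgebra axioms then follow from two properties of \<open>\<sigma>\<close>, naturality
  with respect to the unit and \<open>(Id \<otimes> \<pi>) \<sigma> = \<sigma> (\<pi> \<otimes> Id)\<close> (\<open>primitive_coalgebra\<close>). The second one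
  holds because brackets ignore the unit component of their first argument and take values in \<open>V'\<close>
  (\<open>bracket_proj\<close>).

  Elements are only a way of reading the formulas. The calculations are with arrows, and
  typing conditions are stated through \<open>arr\<close>, \<open>src\<close> and \<open>trg\<close> instead of \<open>mor\<close>: these are
  determined by the arrow, so that the simplifier can discharge them without guessing objects.
\<close>

section \<open>Calculating with typed arrows\<close>

context category
begin

lemma arr_mor: "f \<in> arr C \<Longrightarrow> f \<in> mor C (src C f) (trg C f)"
  by (simp add: mor_def)

lemma mor_iff: "f \<in> mor C A B \<longleftrightarrow> f \<in> arr C \<and> src C f = A \<and> trg C f = B"
  by (simp add: mor_def)

lemma src_trg_obj [simp]: "f \<in> arr C \<Longrightarrow> src C f \<in> obj C" "f \<in> arr C \<Longrightarrow> trg C f \<in> obj C"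
  by (simp_all add: src_obj trg_obj)

lemma id_typing [simp]:
  assumes "A \<in> obj C"
  shows "Id A \<in> arr C" "src C (Id A) = A" "trg C (Id A) = A"
  using id_mor[OF assms] by (simp_all add: mor_iff)

lemma comp_typing [simp]:
  assumes "f \<in> arr C" "g \<in> arr C" "src C g = trg C f"
  shows "g \<cdot> f \<in> arr C" "src C (g \<cdot> f) = src C f" "trg C (g \<cdot> f) = trg C g"
  using comp_mor[of f "src C f" "trg C f" g "trg C g"] assms by (simp_all add: mor_iff)

lemma id_comp [simp]: "f \<in> arr C \<Longrightarrow> trg C f = B \<Longrightarrow> Id B \<cdot> f = f"
  using comp_id_left arr_mor by blast

lemma comp_id [simp]: "f \<in> arr C \<Longrightarrow> src C f = A \<Longrightarrow> f \<cdot> Id A = f"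
  using comp_id_right arr_mor by blast

lemma assoc_comp:
  assumes "f \<in> arr C" "g \<in> arr C" "h \<in> arr C" "src C g = trg C f" "src C h = trg C g"
  shows "(h \<cdot> g) \<cdot> f = h \<cdot> (g \<cdot> f)"
  using comp_assoc[of f "src C f" "trg C f" g "trg C g" h "trg C h"] assms
  by (simp add: mor_iff)

lemma left_inverse_eq_right_inverse:
  assumes "f \<in> mor C A B" "g \<in> mor C B A" "h \<in> mor C B A" "g \<cdot> f = Id A" "f \<cdot> h = Id B"
  shows "g = h"
proof -
  have "g = g \<cdot> (f \<cdot> h)"
    using assms by (simp add: mor_iff)
  also have "\<dots> = (g \<cdot> f) \<cdot> h"
    using assms(1-3) by (simp add: mor_iff assoc_comp)
  also have "\<dots> = h"
    using assms by (simp add: mor_iff)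
  finally show ?thesis .
qed

end

context strict_monoidal_category
begin

lemma unit_obj_simp [simp]: "\<I> \<in> obj C"
  by (rule unit_obj)

lemma tens_obj_simps [simp]:
  "A \<in> obj C \<Longrightarrow> B \<in> obj C \<Longrightarrow> A \<otimes>\<^sub>o B \<in> obj C"
  "A \<in> obj C \<Longrightarrow> \<I> \<otimes>\<^sub>o A = A"
  "A \<in> obj C \<Longrightarrow> A \<otimes>\<^sub>o \<I> = A"
  "A \<in> obj C \<Longrightarrow> B \<in> obj C \<Longrightarrow> E \<in> obj C \<Longrightarrow> (A \<otimes>\<^sub>o B) \<otimes>\<^sub>o E = A \<otimes>\<^sub>o (B \<otimes>\<^sub>o E)"
  by (simp_all add: tens_obj tens_obj_unit_left tens_obj_unit_right tens_obj_assoc)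

lemma tens_typing [simp]:
  assumes "f \<in> arr C" "g \<in> arr C"
  shows "f \<otimes>\<^sub>m g \<in> arr C"
    and "src C (f \<otimes>\<^sub>m g) = src C f \<otimes>\<^sub>o src C g"
    and "trg C (f \<otimes>\<^sub>m g) = trg C f \<otimes>\<^sub>o trg C g"
  using tens_mor[OF arr_mor arr_mor, OF assms] by (simp_all add: mor_iff)

lemma tens_mor_simps [simp]:
  "f \<in> arr C \<Longrightarrow> Id \<I> \<otimes>\<^sub>m f = f"
  "f \<in> arr C \<Longrightarrow> f \<otimes>\<^sub>m Id \<I> = f"
  "A \<in> obj C \<Longrightarrow> B \<in> obj C \<Longrightarrow> Id A \<otimes>\<^sub>m Id B = Id (A \<otimes>\<^sub>o B)"
  "f \<in> arr C \<Longrightarrow> g \<in> arr C \<Longrightarrow> h \<in> arr C \<Longrightarrow> (f \<otimes>\<^sub>m g) \<otimes>\<^sub>m h = f \<otimes>\<^sub>m (g \<otimes>\<^sub>m h)"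
  by (simp_all add: tens_mor_unit_left tens_mor_unit_right tens_id tens_mor_assoc)

lemma interchange:
  assumes "f \<in> arr C" "g \<in> arr C" "f' \<in> arr C" "g' \<in> arr C"
    and "src C g = trg C f" "src C g' = trg C f'"
  shows "(g \<otimes>\<^sub>m g') \<cdot> (f \<otimes>\<^sub>m f') = (g \<cdot> f) \<otimes>\<^sub>m (g' \<cdot> f')"
  using tens_comp[of f "src C f" "trg C f" g "trg C g" f' "src C f'" "trg C f'" g' "trg C g'"] assms
  by (simp add: mor_iff)

text \<open>In right-nested tensor products the cut of one factor may fall after two tensor factors of the
  other; the interchange law is needed in that form as well.\<close>

lemma interchange_cut_after_two:
  assumes "x \<in> arr C" "y \<in> arr C" "z \<in> arr C" "g \<in> arr C" "h \<in> arr C"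
    and "src C g = trg C x \<otimes>\<^sub>o trg C y" "src C h = trg C z"
  shows "(g \<otimes>\<^sub>m h) \<cdot> (x \<otimes>\<^sub>m (y \<otimes>\<^sub>m z)) = (g \<cdot> (x \<otimes>\<^sub>m y)) \<otimes>\<^sub>m (h \<cdot> z)"
  using interchange[of "x \<otimes>\<^sub>m y" g z h] assms by simp

text \<open>An arrow out of \<open>\<I>\<close> creates a strand and therefore slides freely past everything that
  happens before it.\<close>

lemma point_tens_comp:
  assumes "x \<in> arr C" "g \<in> arr C" "h \<in> arr C" "src C x = \<I>" "src C g = trg C h"
  shows "(x \<otimes>\<^sub>m g) \<cdot> h = x \<otimes>\<^sub>m (g \<cdot> h)"
  using interchange[of "Id \<I>" x h g] assms by simp

lemma tens_point_comp:
  assumes "x \<in> arr C" "g \<in> arr C" "h \<in> arr C" "src C x = \<I>" "src C g = trg C h"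
  shows "(g \<otimes>\<^sub>m x) \<cdot> h = (g \<cdot> h) \<otimes>\<^sub>m x"
  using interchange[of h g "Id \<I>" x] assms by simp

lemmas tens_calculus =
  interchange interchange_cut_after_two point_tens_comp tens_point_comp

lemma strand_simps:
  assumes "V \<in> obj C" "f \<in> arr C"
  shows "strand V 1 f 1 = f \<otimes>\<^sub>m Id V" "strand V 2 f 0 = Id V \<otimes>\<^sub>m f"
  using assms by (simp_all add: strand_def numeral_2_eq_2)

end

section \<open>The braiding of an associative algebra\<close>

context right_unital_algebra
begin

lemma algebra_typing [simp]:
  "V \<in> obj C"
  "\<mu> \<in> arr C" "src C \<mu> = V \<otimes>\<^sub>o V" "trg C \<mu> = V"
  "\<nu> \<in> arr C" "src C \<nu> = \<I>" "trg C \<nu> = V"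
  using V_obj mult_mor unit_mor by (simp_all add: mor_iff)

lemma sigma_Ass_strands:
  "strand V 1 (sigma_Ass C \<mu> \<nu>) 1 = \<nu> \<otimes>\<^sub>m \<mu> \<otimes>\<^sub>m Id V"
  "strand V 2 (sigma_Ass C \<mu> \<nu>) 0 = Id V \<otimes>\<^sub>m \<nu> \<otimes>\<^sub>m \<mu>"
  by (simp_all add: sigma_Ass_def strand_simps del: One_nat_def)

text \<open>In elements this is \<open>\<sigma>\<^sub>1 \<sigma>\<^sub>2 (a, b, c) = (1, a 1, b c)\<close>: the right unit law restores \<open>a\<close>.\<close>

lemma sigma_Ass_1_2:
  "(\<nu> \<otimes>\<^sub>m \<mu> \<otimes>\<^sub>m Id V) \<cdot> (Id V \<otimes>\<^sub>m \<nu> \<otimes>\<^sub>m \<mu>) = \<nu> \<otimes>\<^sub>m Id V \<otimes>\<^sub>m \<mu>"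
proof -
  have "(\<nu> \<otimes>\<^sub>m \<mu> \<otimes>\<^sub>m Id V) \<cdot> (Id V \<otimes>\<^sub>m \<nu> \<otimes>\<^sub>m \<mu>) = \<nu> \<otimes>\<^sub>m (\<mu> \<cdot> (Id V \<otimes>\<^sub>m \<nu>)) \<otimes>\<^sub>m \<mu>"
    by (simp add: tens_calculus)
  then show ?thesis
    by (simp add: mult_unit_right)
qed

theorem pre_braided_Ass: "pre_braided_object C V (sigma_Ass C \<mu> \<nu>)"
proof
  let ?\<sigma>1 = "\<nu> \<otimes>\<^sub>m \<mu> \<otimes>\<^sub>m Id V" and ?\<sigma>2 = "Id V \<otimes>\<^sub>m \<nu> \<otimes>\<^sub>m \<mu>"
  have "?\<sigma>1 \<cdot> ?\<sigma>2 \<cdot> ?\<sigma>1 = (?\<sigma>1 \<cdot> ?\<sigma>2) \<cdot> ?\<sigma>1"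
    by (simp add: assoc_comp)
  also have "\<dots> = \<nu> \<otimes>\<^sub>m \<nu> \<otimes>\<^sub>m (\<mu> \<cdot> (\<mu> \<otimes>\<^sub>m Id V))"
    unfolding sigma_Ass_1_2 by (simp add: tens_calculus)
  also have "\<dots> = \<nu> \<otimes>\<^sub>m \<nu> \<otimes>\<^sub>m (\<mu> \<cdot> (Id V \<otimes>\<^sub>m \<mu>))"
    by (simp only: mult_assoc)
  also have "\<dots> = ?\<sigma>2 \<cdot> ?\<sigma>1 \<cdot> ?\<sigma>2"
    unfolding sigma_Ass_1_2 by (simp add: tens_calculus)
  finally show "strand V 1 (sigma_Ass C \<mu> \<nu>) 1 \<cdot> strand V 2 (sigma_Ass C \<mu> \<nu>) 0
      \<cdot> strand V 1 (sigma_Ass C \<mu> \<nu>) 1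
    = strand V 2 (sigma_Ass C \<mu> \<nu>) 0 \<cdot> strand V 1 (sigma_Ass C \<mu> \<nu>) 1
      \<cdot> strand V 2 (sigma_Ass C \<mu> \<nu>) 0"
    unfolding sigma_Ass_strands .
qed (simp_all add: sigma_Ass_def mor_iff)

lemma demi_natural_Ass: "demi_natural C V (sigma_Ass C \<mu> \<nu>) \<nu>"
  by (simp add: demi_natural_def sigma_Ass_def unit_mor tens_calculus mult_unit_right)

end

context unital_algebra
begin

lemma Delta_Ass_strands:
  "strand V 1 (Delta_Ass C V \<nu>) 1 = \<nu> \<otimes>\<^sub>m Id (V \<otimes>\<^sub>o V)"
  "strand V 2 (Delta_Ass C V \<nu>) 0 = Id V \<otimes>\<^sub>m \<nu> \<otimes>\<^sub>m Id V"
  by (simp_all add: Delta_Ass_def strand_simps del: One_nat_def)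

text \<open>In elements \<open>\<Delta> a = (1, a)\<close>, and the two compatibility conditions hold because every composite
  involved sends \<open>(a, b)\<close> to \<open>(1, 1, a b)\<close>.\<close>

theorem pre_braided_coalgebra_Ass:
  "pre_braided_coalgebra C V (sigma_Ass C \<mu> \<nu>) (Delta_Ass C V \<nu>)"
proof -
  interpret pre_braided_object C V "sigma_Ass C \<mu> \<nu>"
    by (rule pre_braided_Ass)
  let ?\<sigma>1 = "\<nu> \<otimes>\<^sub>m \<mu> \<otimes>\<^sub>m Id V" and ?\<sigma>2 = "Id V \<otimes>\<^sub>m \<nu> \<otimes>\<^sub>m \<mu>"
  let ?\<Delta>1 = "\<nu> \<otimes>\<^sub>m Id (V \<otimes>\<^sub>o V)" and ?\<Delta>2 = "Id V \<otimes>\<^sub>m \<nu> \<otimes>\<^sub>m Id V"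
  have "?\<sigma>1 \<cdot> ?\<sigma>2 \<cdot> ?\<Delta>1 = (?\<sigma>1 \<cdot> ?\<sigma>2) \<cdot> ?\<Delta>1"
    by (simp add: assoc_comp)
  also have "\<dots> = \<nu> \<otimes>\<^sub>m ((Id V \<otimes>\<^sub>m \<mu>) \<cdot> (\<nu> \<otimes>\<^sub>m Id (V \<otimes>\<^sub>o V)))"
    unfolding sigma_Ass_1_2 by (simp add: tens_calculus)
  also have "\<dots> = \<nu> \<otimes>\<^sub>m \<nu> \<otimes>\<^sub>m \<mu>"
    by (simp add: interchange)
  finally have right: "?\<sigma>1 \<cdot> ?\<sigma>2 \<cdot> ?\<Delta>1 = \<nu> \<otimes>\<^sub>m \<nu> \<otimes>\<^sub>m \<mu>" .
  have "?\<sigma>1 \<cdot> ?\<Delta>2 = \<nu> \<otimes>\<^sub>m (\<mu> \<cdot> (Id V \<otimes>\<^sub>m \<nu>)) \<otimes>\<^sub>m Id V"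
    by (simp add: point_tens_comp interchange_cut_after_two)
  then have "?\<sigma>1 \<cdot> ?\<Delta>2 = ?\<Delta>1"
    by (simp add: mult_unit_right)
  then have left: "?\<sigma>2 \<cdot> ?\<sigma>1 \<cdot> ?\<Delta>2 = \<nu> \<otimes>\<^sub>m \<nu> \<otimes>\<^sub>m \<mu>"
    by (simp add: interchange)
  show ?thesis
    by unfold_locales
      (simp_all only: sigma_Ass_strands Delta_Ass_strands right left,
       simp_all add: sigma_Ass_def Delta_Ass_def mor_iff tens_calculus)
qed

lemma cocommutative_Ass: "cocommutative C (sigma_Ass C \<mu> \<nu>) (Delta_Ass C V \<nu>)"
  by (simp add: cocommutative_def sigma_Ass_def Delta_Ass_def point_tens_comp mult_unit_left)

end

context algebra_character
begin

theorem braided_character_Ass: "braided_character C V (sigma_Ass C \<mu> \<nu>) \<epsilon>"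
proof -
  interpret pre_braided_object C V "sigma_Ass C \<mu> \<nu>"
    by (rule pre_braided_Ass)
  have [simp]: "\<epsilon> \<in> arr C" "src C \<epsilon> = V" "trg C \<epsilon> = \<I>"
    using char_mor by (simp_all add: mor_iff)
  show ?thesis
    by unfold_locales
      (simp_all add: char_mor sigma_Ass_def interchange char_mult char_unit)
qed

lemma normalized_Ass: "normalized_pair C V \<nu> \<epsilon>"
  by (simp add: normalized_pair_def unit_mor char_mor char_unit)

end

section \<open>Symmetric braidings\<close>

context symmetric_strict_monoidal_category
begin

lemma braid_typing [simp]:
  assumes "A \<in> obj C" "B \<in> obj C"
  shows "c A B \<in> arr C" "src C (c A B) = A \<otimes>\<^sub>o B" "trg C (c A B) = B \<otimes>\<^sub>o A"
  using braid_mor[OF assms] by (simp_all add: mor_iff)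

lemma braid_tens:
  assumes "f \<in> arr C" "g \<in> arr C" "trg C f = A" "trg C g = B"
  shows "c A B \<cdot> (f \<otimes>\<^sub>m g) = (g \<otimes>\<^sub>m f) \<cdot> c (src C f) (src C g)"
  using braid_natural[OF arr_mor arr_mor, OF assms(1,2)] assms(3,4) by simp

text \<open>The hexagon identity at \<open>A\<close>, \<open>\<I>\<close>, \<open>\<I>\<close> says that \<open>c A \<I>\<close> is idempotent, and it is invertible.\<close>

lemma braid_unit [simp]:
  assumes "A \<in> obj C"
  shows "c A \<I> = Id A" "c \<I> A = Id A"
proof -
  have idem: "c A \<I> = c A \<I> \<cdot> c A \<I>"
    using braid_hexagon[OF assms unit_obj unit_obj] assms by simp
  have inv: "c \<I> A \<cdot> c A \<I> = Id A"
    using braid_symmetric[OF assms unit_obj] assms by simp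
  have "c \<I> A \<cdot> c A \<I> = (c \<I> A \<cdot> c A \<I>) \<cdot> c A \<I>"
    using idem assms by (simp add: assoc_comp)
  then show right: "c A \<I> = Id A"
    using inv assms by simp
  show "c \<I> A = Id A"
    using inv right assms by simp
qed

lemma braid_points:
  assumes "f \<in> arr C" "x \<in> arr C" "src C x = \<I>" "trg C f = A" "trg C x = B"
  shows "c A B \<cdot> (f \<otimes>\<^sub>m x) = x \<otimes>\<^sub>m f" "c B A \<cdot> (x \<otimes>\<^sub>m f) = f \<otimes>\<^sub>m x"
  using assms by (simp_all add: braid_tens)

text \<open>Both sides are inverse to \<open>c E (A \<otimes>\<^sub>o B)\<close>.\<close>

lemma braid_hexagon_left:
  assumes "A \<in> obj C" "B \<in> obj C" "E \<in> obj C"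
  shows "c (A \<otimes>\<^sub>o B) E = (c A E \<otimes>\<^sub>m Id B) \<cdot> (Id A \<otimes>\<^sub>m c B E)"
proof -
  let ?d = "(c A E \<otimes>\<^sub>m Id B) \<cdot> (Id A \<otimes>\<^sub>m c B E)"
  have hex: "c E (A \<otimes>\<^sub>o B) = (Id A \<otimes>\<^sub>m c E B) \<cdot> (c E A \<otimes>\<^sub>m Id B)"
    using braid_hexagon[of E A B] assms by simp
  have "?d \<cdot> c E (A \<otimes>\<^sub>o B)
    = (c A E \<otimes>\<^sub>m Id B) \<cdot> (Id A \<otimes>\<^sub>m (c B E \<cdot> c E B)) \<cdot> (c E A \<otimes>\<^sub>m Id B)"
  proof -
    have "(Id A \<otimes>\<^sub>m c B E) \<cdot> (Id A \<otimes>\<^sub>m c E B) \<cdot> (c E A \<otimes>\<^sub>m Id B)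
      = ((Id A \<otimes>\<^sub>m c B E) \<cdot> (Id A \<otimes>\<^sub>m c E B)) \<cdot> (c E A \<otimes>\<^sub>m Id B)"
      using assms by (simp add: assoc_comp)
    then show ?thesis
      using assms by (simp add: hex assoc_comp interchange)
  qed
  also have "\<dots> = Id (E \<otimes>\<^sub>o A \<otimes>\<^sub>o B)"
    using assms by (simp add: braid_symmetric interchange)
  finally have "?d \<cdot> c E (A \<otimes>\<^sub>o B) = Id (E \<otimes>\<^sub>o A \<otimes>\<^sub>o B)" .
  moreover have "c E (A \<otimes>\<^sub>o B) \<cdot> c (A \<otimes>\<^sub>o B) E = Id (A \<otimes>\<^sub>o B \<otimes>\<^sub>o E)"
    using braid_symmetric[of "A \<otimes>\<^sub>o B" E] assms by simp
  ultimately show ?thesis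
    using left_inverse_eq_right_inverse[of "c E (A \<otimes>\<^sub>o B)" "E \<otimes>\<^sub>o A \<otimes>\<^sub>o B" "A \<otimes>\<^sub>o B \<otimes>\<^sub>o E" ?d
        "c (A \<otimes>\<^sub>o B) E"] assms
    by (simp add: mor_iff)
qed

lemma braid_yang_baxter:
  assumes V: "V \<in> obj C"
  defines "c1 \<equiv> c V V \<otimes>\<^sub>m Id V" and "c2 \<equiv> Id V \<otimes>\<^sub>m c V V"
  shows "c1 \<cdot> c2 \<cdot> c1 = c2 \<cdot> c1 \<cdot> c2"
proof -
  have "c1 \<cdot> c2 \<cdot> c1 = c (V \<otimes>\<^sub>o V) V \<cdot> (c V V \<otimes>\<^sub>m Id V)"
    using V by (simp add: c1_def c2_def braid_hexagon_left assoc_comp)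
  also have "\<dots> = (Id V \<otimes>\<^sub>m c V V) \<cdot> c (V \<otimes>\<^sub>o V) V"
    using V by (simp add: braid_tens)
  also have "\<dots> = c2 \<cdot> c1 \<cdot> c2"
    using V by (simp add: c1_def c2_def braid_hexagon_left)
  finally show ?thesis .
qed

end

section \<open>Addition of arrows\<close>

context preadditive_category
begin

lemma hom_group_simps [simp]:
  "carrier (hom_group C A B) = mor C A B"
  "x \<otimes>\<^bsub>hom_group C A B\<^esub> y = x +\<^sub>m y"
  "\<one>\<^bsub>hom_group C A B\<^esub> = \<zero>\<^sub>m A B"
  by (simp_all add: hom_group_def)

lemma zero_typing [simp]:
  assumes "A \<in> obj C" "B \<in> obj C"
  shows "\<zero>\<^sub>m A B \<in> arr C" "src C (\<zero>\<^sub>m A B) = A" "trg C (\<zero>\<^sub>m A B) = B"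
proof -
  interpret hom: comm_group "hom_group C A B"
    using assms by (rule hom_comm_group)
  show "\<zero>\<^sub>m A B \<in> arr C" "src C (\<zero>\<^sub>m A B) = A" "trg C (\<zero>\<^sub>m A B) = B"
    using hom.one_closed by (simp_all add: mor_iff)
qed

lemma add_typing [simp]:
  assumes "f \<in> arr C" "g \<in> arr C" "src C g = src C f" "trg C g = trg C f"
  shows "f +\<^sub>m g \<in> arr C" "src C (f +\<^sub>m g) = src C f" "trg C (f +\<^sub>m g) = trg C f"
proof -
  interpret hom: comm_group "hom_group C (src C f) (trg C f)"
    using assms by (simp add: hom_comm_group)
  show "f +\<^sub>m g \<in> arr C" "src C (f +\<^sub>m g) = src C f" "trg C (f +\<^sub>m g) = trg C f"
    using hom.m_closed[of f g] assms by (simp_all add: mor_iff)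
qed

lemma add_zero [simp]:
  assumes "f \<in> arr C" "src C f = A" "trg C f = B"
  shows "f +\<^sub>m \<zero>\<^sub>m A B = f" "\<zero>\<^sub>m A B +\<^sub>m f = f"
proof -
  interpret hom: comm_group "hom_group C A B"
    using assms by (auto intro: hom_comm_group)
  show "f +\<^sub>m \<zero>\<^sub>m A B = f" "\<zero>\<^sub>m A B +\<^sub>m f = f"
    using hom.r_one[of f] hom.l_one[of f] assms by (simp_all add: mor_iff)
qed

lemma add_assoc:
  assumes "f \<in> arr C" "g \<in> arr C" "h \<in> arr C"
    and "src C g = src C f" "trg C g = trg C f" "src C h = src C f" "trg C h = trg C f"
  shows "(f +\<^sub>m g) +\<^sub>m h = f +\<^sub>m (g +\<^sub>m h)"
proof -
  interpret hom: comm_group "hom_group C (src C f) (trg C f)"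
    using assms by (simp add: hom_comm_group)
  show ?thesis
    using hom.m_assoc[of f g h] assms by (simp add: mor_iff)
qed

lemma add_commute:
  assumes "f \<in> arr C" "g \<in> arr C" "src C g = src C f" "trg C g = trg C f"
  shows "f +\<^sub>m g = g +\<^sub>m f"
proof -
  interpret hom: comm_group "hom_group C (src C f) (trg C f)"
    using assms by (simp add: hom_comm_group)
  show ?thesis
    using hom.m_comm[of f g] assms by (simp add: mor_iff)
qed

lemma add_left_commute:
  assumes "f \<in> arr C" "g \<in> arr C" "h \<in> arr C"
    and "src C g = src C f" "trg C g = trg C f" "src C h = src C f" "trg C h = trg C f"
  shows "f +\<^sub>m (g +\<^sub>m h) = g +\<^sub>m (f +\<^sub>m h)"
  using assms add_commute[of f g] by (simp flip: add_assoc)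

lemmas add_ac = add_assoc add_commute add_left_commute

lemma add_right_cancel:
  assumes "f \<in> arr C" "g \<in> arr C" "h \<in> arr C"
    and "src C g = src C f" "trg C g = trg C f" "src C h = src C f" "trg C h = trg C f"
  shows "f +\<^sub>m h = g +\<^sub>m h \<longleftrightarrow> f = g"
proof -
  interpret hom: comm_group "hom_group C (src C f) (trg C f)"
    using assms by (simp add: hom_comm_group)
  show ?thesis
    using hom.right_cancel[of h f g] assms by (auto simp add: mor_iff)
qed

lemma sub_simps [simp]:
  assumes "f \<in> arr C" "g \<in> arr C" "src C g = src C f" "trg C g = trg C f"
  shows "f -\<^sub>m g \<in> arr C" "src C (f -\<^sub>m g) = src C f" "trg C (f -\<^sub>m g) = trg C f"
    and "(f -\<^sub>m g) +\<^sub>m g = f"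
proof -
  interpret hom: comm_group "hom_group C (src C f) (trg C f)"
    using assms by (simp add: hom_comm_group)
  let ?n = "inv\<^bsub>hom_group C (src C f) (trg C f)\<^esub> g"
  have sub: "f -\<^sub>m g = f +\<^sub>m ?n"
    using assms by (simp add: msub_def)
  have g: "g \<in> carrier (hom_group C (src C f) (trg C f))"
    using assms by (simp add: mor_iff)
  then have n: "?n \<in> arr C" "src C ?n = src C f" "trg C ?n = trg C f"
    using hom.inv_closed[OF g] by (simp_all add: mor_iff)
  then show "f -\<^sub>m g \<in> arr C" "src C (f -\<^sub>m g) = src C f" "trg C (f -\<^sub>m g) = trg C f"
    using assms by (simp_all add: sub)
  have "?n +\<^sub>m g = \<zero>\<^sub>m (src C f) (trg C f)"
    using hom.l_inv[OF g] by simp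
  then show "(f -\<^sub>m g) +\<^sub>m g = f"
    using assms n by (simp add: sub add_assoc)
qed

lemma comp_add:
  assumes "f \<in> arr C" "g \<in> arr C" "h \<in> arr C" "src C g = src C f" "trg C g = trg C f"
  shows "src C h = trg C f \<Longrightarrow> h \<cdot> (f +\<^sub>m g) = h \<cdot> f +\<^sub>m h \<cdot> g"
    and "src C f = trg C h \<Longrightarrow> (f +\<^sub>m g) \<cdot> h = f \<cdot> h +\<^sub>m g \<cdot> h"
  using comp_add_right[of f "src C f" "trg C f" g h "trg C h"]
    comp_add_left[of h "src C h" "trg C h" f "trg C f" g] assms
  by (simp_all add: mor_iff)

lemma comp_zero [simp]:
  assumes "f \<in> arr C" "E \<in> obj C"
  shows "trg C f = A \<Longrightarrow> \<zero>\<^sub>m A E \<cdot> f = \<zero>\<^sub>m (src C f) E"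
    and "src C f = B \<Longrightarrow> f \<cdot> \<zero>\<^sub>m E B = \<zero>\<^sub>m E (trg C f)"
proof -
  let ?l = "\<zero>\<^sub>m (trg C f) E \<cdot> f" and ?r = "f \<cdot> \<zero>\<^sub>m E (src C f)"
  have "?l +\<^sub>m ?l = \<zero>\<^sub>m (src C f) E +\<^sub>m ?l"
    using comp_add(2)[of "\<zero>\<^sub>m (trg C f) E" "\<zero>\<^sub>m (trg C f) E" f] assms by simp
  then show "trg C f = A \<Longrightarrow> \<zero>\<^sub>m A E \<cdot> f = \<zero>\<^sub>m (src C f) E"
    using assms by (auto simp add: add_right_cancel simp del: add_zero)
  have "?r +\<^sub>m ?r = \<zero>\<^sub>m E (trg C f) +\<^sub>m ?r"
    using comp_add(1)[of "\<zero>\<^sub>m E (src C f)" "\<zero>\<^sub>m E (src C f)" f] assms by simp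
  then show "src C f = B \<Longrightarrow> f \<cdot> \<zero>\<^sub>m E B = \<zero>\<^sub>m E (trg C f)"
    using assms by (auto simp add: add_right_cancel simp del: add_zero)
qed

text \<open>Bilinearity expands both sides of the Yang--Baxter equation for \<open>\<sigma>\<^sub>i = c\<^sub>i + b\<^sub>i\<close> into
  eight terms. The hypotheses match the terms with at most one factor \<open>b\<close>. Of those with two or
  three, only one on the left and two on the right survive, and the relation \<open>cbb\<close> between these
  has the shape of the Leibniz identity.\<close>

lemma yang_baxter_sum:
  assumes typing: "c1 \<in> mor C X X" "c2 \<in> mor C X X" "b1 \<in> mor C X X" "b2 \<in> mor C X X"
    and ccc: "c1 \<cdot> c2 \<cdot> c1 = c2 \<cdot> c1 \<cdot> c2"
    and ccb: "c1 \<cdot> c2 \<cdot> b1 = b2 \<cdot> c1 \<cdot> c2"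
    and cbc: "c1 \<cdot> b2 \<cdot> c1 = c2 \<cdot> b1 \<cdot> c2"
    and bcc: "b1 \<cdot> c2 \<cdot> c1 = c2 \<cdot> c1 \<cdot> b2"
    and cbb: "c1 \<cdot> b2 \<cdot> b1 = b2 \<cdot> c1 \<cdot> b2 +\<^sub>m b2 \<cdot> b1 \<cdot> c2"
    and bb: "b1 \<cdot> b2 = \<zero>\<^sub>m X X"
    and bcb: "b1 \<cdot> c2 \<cdot> b1 = \<zero>\<^sub>m X X"
  shows "(c1 +\<^sub>m b1) \<cdot> (c2 +\<^sub>m b2) \<cdot> (c1 +\<^sub>m b1) = (c2 +\<^sub>m b2) \<cdot> (c1 +\<^sub>m b1) \<cdot> (c2 +\<^sub>m b2)"
proof -
  have [simp]: "X \<in> obj C"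
    using typing(1) by (auto simp add: mor_iff)
  note typing [unfolded mor_iff, simp]
  have zeros: "b1 \<cdot> b2 \<cdot> f = \<zero>\<^sub>m X X" if "f \<in> mor C X X" for f
    using assoc_comp[of f b2 b1] that by (simp add: bb mor_iff)
  have bbc: "b1 \<cdot> b2 \<cdot> c1 = \<zero>\<^sub>m X X" and bbb: "b1 \<cdot> b2 \<cdot> b1 = \<zero>\<^sub>m X X"
    by (simp_all add: zeros typing)
  show ?thesis
    by (simp add: comp_add ccc ccb cbc bcc cbb bb bcb bbc bbb add_ac)
qed

end

context preadditive_strict_monoidal_category
begin

lemma tens_add:
  assumes "f \<in> arr C" "g \<in> arr C" "h \<in> arr C" "src C g = src C f" "trg C g = trg C f"
  shows "h \<otimes>\<^sub>m (f +\<^sub>m g) = h \<otimes>\<^sub>m f +\<^sub>m h \<otimes>\<^sub>m g"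
    and "(f +\<^sub>m g) \<otimes>\<^sub>m h = f \<otimes>\<^sub>m h +\<^sub>m g \<otimes>\<^sub>m h"
  using tens_add_right[of h "src C h" "trg C h" f "src C f" "trg C f" g]
    tens_add_left[of f "src C f" "trg C f" g h "src C h" "trg C h"] assms
  by (simp_all add: mor_iff)

lemma tens_zero [simp]:
  assumes "f \<in> arr C" "A \<in> obj C" "B \<in> obj C"
  shows "f \<otimes>\<^sub>m \<zero>\<^sub>m A B = \<zero>\<^sub>m (src C f \<otimes>\<^sub>o A) (trg C f \<otimes>\<^sub>o B)"
    and "\<zero>\<^sub>m A B \<otimes>\<^sub>m f = \<zero>\<^sub>m (A \<otimes>\<^sub>o src C f) (B \<otimes>\<^sub>o trg C f)"
proof -
  let ?r = "f \<otimes>\<^sub>m \<zero>\<^sub>m A B" and ?l = "\<zero>\<^sub>m A B \<otimes>\<^sub>m f"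
  have "?r +\<^sub>m ?r = \<zero>\<^sub>m (src C f \<otimes>\<^sub>o A) (trg C f \<otimes>\<^sub>o B) +\<^sub>m ?r"
    using tens_add(1)[of "\<zero>\<^sub>m A B" "\<zero>\<^sub>m A B" f] assms by simp
  then show "?r = \<zero>\<^sub>m (src C f \<otimes>\<^sub>o A) (trg C f \<otimes>\<^sub>o B)"
    using assms by (simp add: add_right_cancel del: add_zero)
  have "?l +\<^sub>m ?l = \<zero>\<^sub>m (A \<otimes>\<^sub>o src C f) (B \<otimes>\<^sub>o trg C f) +\<^sub>m ?l"
    using tens_add(2)[of "\<zero>\<^sub>m A B" "\<zero>\<^sub>m A B" f] assms by simp
  then show "?l = \<zero>\<^sub>m (A \<otimes>\<^sub>o src C f) (B \<otimes>\<^sub>o trg C f)"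
    using assms by (simp add: add_right_cancel del: add_zero)
qed

end

section \<open>The coalgebra with primitive elements\<close>

context preadditive_strict_monoidal_category
begin

text \<open>In elements \<open>\<Delta> a = (1, a) + (\<pi> a, 1)\<close>, where \<open>\<pi>\<close> projects onto a complement of the unit. Elements
  of the complement are primitive and \<open>1\<close> is group-like, whence coassociativity. The compatibility
  with \<open>\<sigma>\<close> holds term by term: \<open>\<sigma>\<close> moves \<open>1\<close> past every element, and it transports \<open>\<pi>\<close> from the
  first strand to the second.\<close>

lemma primitive_coalgebra:
  assumes braided: "pre_braided_object C V \<sigma>" and natural: "natural_wrt C V \<sigma> \<nu>"
    and proj: "\<pi> \<in> mor C V V" "q \<in> mor C V \<I>"
    and split: "Id V = \<pi> +\<^sub>m \<nu> \<cdot> q" and proj_unit: "\<pi> \<cdot> \<nu> = \<zero>\<^sub>m \<I> V"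
    and slide: "(Id V \<otimes>\<^sub>m \<pi>) \<cdot> \<sigma> = \<sigma> \<cdot> (\<pi> \<otimes>\<^sub>m Id V)"
  defines "\<Delta> \<equiv> \<nu> \<otimes>\<^sub>m Id V +\<^sub>m \<pi> \<otimes>\<^sub>m \<nu>"
  shows "semi_pre_braided_coalgebra C V \<sigma> \<Delta>" and "cocommutative C \<sigma> \<Delta>"
proof -
  interpret pre_braided_object C V \<sigma>
    by (rule braided)
  note V_obj [simp]
  have [simp]: "\<sigma> \<in> arr C" "src C \<sigma> = V \<otimes>\<^sub>o V" "trg C \<sigma> = V \<otimes>\<^sub>o V"
    "\<nu> \<in> arr C" "src C \<nu> = \<I>" "trg C \<nu> = V" "\<pi> \<in> arr C" "src C \<pi> = V" "trg C \<pi> = V"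
    "q \<in> arr C" "src C q = V" "trg C q = \<I>"
    using sigma_mor natural proj by (simp_all add: mor_iff natural_wrt_def demi_natural_def)
  have nat: "\<sigma> \<cdot> (Id V \<otimes>\<^sub>m \<nu>) = \<nu> \<otimes>\<^sub>m Id V" "\<sigma> \<cdot> (\<nu> \<otimes>\<^sub>m Id V) = Id V \<otimes>\<^sub>m \<nu>"
    using natural by (simp_all add: natural_wrt_def demi_natural_def)
  have nat_pi: "\<sigma> \<cdot> (\<pi> \<otimes>\<^sub>m \<nu>) = \<nu> \<otimes>\<^sub>m \<pi>"
  proof -
    have "\<pi> \<otimes>\<^sub>m \<nu> = (Id V \<otimes>\<^sub>m \<nu>) \<cdot> \<pi>"
      by (simp add: tens_point_comp)
    then have "\<sigma> \<cdot> (\<pi> \<otimes>\<^sub>m \<nu>) = (\<sigma> \<cdot> (Id V \<otimes>\<^sub>m \<nu>)) \<cdot> \<pi>"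
      by (simp add: assoc_comp)
    then show ?thesis
      by (simp add: nat point_tens_comp)
  qed
  have idem: "\<pi> \<cdot> \<pi> = \<pi>"
  proof -
    have "\<pi> \<cdot> (\<nu> \<cdot> q) = \<zero>\<^sub>m V V"
      using assoc_comp[of q \<nu> \<pi>] by (simp add: proj_unit)
    moreover have "\<pi> \<cdot> Id V = \<pi> \<cdot> \<pi> +\<^sub>m \<pi> \<cdot> (\<nu> \<cdot> q)"
      by (simp only: split) (simp add: comp_add)
    ultimately show ?thesis
      by simp
  qed
  have [simp]: "\<Delta> \<in> arr C" "src C \<Delta> = V" "trg C \<Delta> = V \<otimes>\<^sub>o V"
    by (simp_all add: \<Delta>_def)
  have group_like: "\<Delta> \<cdot> \<nu> = \<nu> \<otimes>\<^sub>m \<nu>"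
    by (simp add: \<Delta>_def comp_add point_tens_comp tens_point_comp proj_unit)
  have \<Delta>_pi: "\<Delta> \<cdot> \<pi> = \<nu> \<otimes>\<^sub>m \<pi> +\<^sub>m \<pi> \<otimes>\<^sub>m \<nu>"
    by (simp add: \<Delta>_def comp_add point_tens_comp tens_point_comp idem)
  have strands: "strand V 1 \<Delta> 1 = \<Delta> \<otimes>\<^sub>m Id V" "strand V 2 \<Delta> 0 = Id V \<otimes>\<^sub>m \<Delta>"
    "strand V 1 \<sigma> 1 = \<sigma> \<otimes>\<^sub>m Id V" "strand V 2 \<sigma> 0 = Id V \<otimes>\<^sub>m \<sigma>"
    by (simp_all add: strand_simps del: One_nat_def)
  have coassoc: "(\<Delta> \<otimes>\<^sub>m Id V) \<cdot> \<Delta> = (Id V \<otimes>\<^sub>m \<Delta>) \<cdot> \<Delta>"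
  proof -
    have "(\<Delta> \<otimes>\<^sub>m Id V) \<cdot> \<Delta> = (\<Delta> \<otimes>\<^sub>m Id V) \<cdot> (\<nu> \<otimes>\<^sub>m Id V) +\<^sub>m (\<Delta> \<otimes>\<^sub>m Id V) \<cdot> (\<pi> \<otimes>\<^sub>m \<nu>)"
      by (subst (2) \<Delta>_def) (simp add: comp_add)
    also have "\<dots> = \<nu> \<otimes>\<^sub>m \<nu> \<otimes>\<^sub>m Id V +\<^sub>m (\<nu> \<otimes>\<^sub>m \<pi> \<otimes>\<^sub>m \<nu> +\<^sub>m \<pi> \<otimes>\<^sub>m \<nu> \<otimes>\<^sub>m \<nu>)"
      by (simp add: interchange group_like \<Delta>_pi tens_add)
    also have "\<dots> = \<nu> \<otimes>\<^sub>m \<Delta> +\<^sub>m \<pi> \<otimes>\<^sub>m (\<Delta> \<cdot> \<nu>)"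
      by (simp add: group_like) (simp add: \<Delta>_def tens_add add_ac)
    also have "\<dots> = (Id V \<otimes>\<^sub>m \<Delta>) \<cdot> (\<nu> \<otimes>\<^sub>m Id V) +\<^sub>m (Id V \<otimes>\<^sub>m \<Delta>) \<cdot> (\<pi> \<otimes>\<^sub>m \<nu>)"
      by (simp add: interchange)
    also have "\<dots> = (Id V \<otimes>\<^sub>m \<Delta>) \<cdot> \<Delta>"
      by (subst (4) \<Delta>_def) (simp add: comp_add)
    finally show ?thesis .
  qed
  have compat: "(Id V \<otimes>\<^sub>m \<Delta>) \<cdot> \<sigma> = (\<sigma> \<otimes>\<^sub>m Id V) \<cdot> (Id V \<otimes>\<^sub>m \<sigma>) \<cdot> (\<Delta> \<otimes>\<^sub>m Id V)"
  proof -
    have "(Id V \<otimes>\<^sub>m \<sigma>) \<cdot> (\<Delta> \<otimes>\<^sub>m Id V)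
      = (Id V \<otimes>\<^sub>m \<sigma>) \<cdot> (\<nu> \<otimes>\<^sub>m Id (V \<otimes>\<^sub>o V)) +\<^sub>m (Id V \<otimes>\<^sub>m \<sigma>) \<cdot> (\<pi> \<otimes>\<^sub>m (\<nu> \<otimes>\<^sub>m Id V))"
      by (simp add: \<Delta>_def tens_add comp_add)
    also have "\<dots> = \<nu> \<otimes>\<^sub>m \<sigma> +\<^sub>m \<pi> \<otimes>\<^sub>m Id V \<otimes>\<^sub>m \<nu>"
      by (simp add: interchange nat)
    finally have step: "(Id V \<otimes>\<^sub>m \<sigma>) \<cdot> (\<Delta> \<otimes>\<^sub>m Id V) = \<nu> \<otimes>\<^sub>m \<sigma> +\<^sub>m \<pi> \<otimes>\<^sub>m Id V \<otimes>\<^sub>m \<nu>" .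
    have "\<nu> \<otimes>\<^sub>m \<sigma> = (\<nu> \<otimes>\<^sub>m Id V \<otimes>\<^sub>m Id V) \<cdot> \<sigma>"
      by (simp add: point_tens_comp)
    then have "(\<sigma> \<otimes>\<^sub>m Id V) \<cdot> (\<nu> \<otimes>\<^sub>m \<sigma>) = ((\<sigma> \<otimes>\<^sub>m Id V) \<cdot> (\<nu> \<otimes>\<^sub>m Id V \<otimes>\<^sub>m Id V)) \<cdot> \<sigma>"
      by (simp add: assoc_comp)
    also have "(\<sigma> \<otimes>\<^sub>m Id V) \<cdot> (\<nu> \<otimes>\<^sub>m Id V \<otimes>\<^sub>m Id V) = Id V \<otimes>\<^sub>m \<nu> \<otimes>\<^sub>m Id V"
      by (subst interchange_cut_after_two) (simp_all add: nat)
    finally have one: "(\<sigma> \<otimes>\<^sub>m Id V) \<cdot> (\<nu> \<otimes>\<^sub>m \<sigma>) = (Id V \<otimes>\<^sub>m \<nu> \<otimes>\<^sub>m Id V) \<cdot> \<sigma>" .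
    have "(\<sigma> \<otimes>\<^sub>m Id V) \<cdot> (\<pi> \<otimes>\<^sub>m Id V \<otimes>\<^sub>m \<nu>) = ((Id V \<otimes>\<^sub>m \<pi>) \<cdot> \<sigma>) \<otimes>\<^sub>m \<nu>"
      by (simp add: interchange_cut_after_two slide)
    also have "\<dots> = (Id V \<otimes>\<^sub>m \<pi> \<otimes>\<^sub>m \<nu>) \<cdot> \<sigma>"
      using tens_point_comp[of \<nu> "Id V \<otimes>\<^sub>m \<pi>" \<sigma>] by simp
    finally have two: "(\<sigma> \<otimes>\<^sub>m Id V) \<cdot> (\<pi> \<otimes>\<^sub>m Id V \<otimes>\<^sub>m \<nu>) = (Id V \<otimes>\<^sub>m \<pi> \<otimes>\<^sub>m \<nu>) \<cdot> \<sigma>" .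
    show ?thesis
      by (simp add: step comp_add one two) (simp add: \<Delta>_def tens_add comp_add)
  qed
  show "semi_pre_braided_coalgebra C V \<sigma> \<Delta>"
    by unfold_locales (simp_all only: strands coassoc compat, simp_all add: mor_iff)
  (* (1, a) and (a, 1) exceed (1, \<pi> a) and (\<pi> a, 1) by the same multiple of (1, 1). *)
  have sym: "\<nu> \<otimes>\<^sub>m Id V = \<nu> \<otimes>\<^sub>m \<pi> +\<^sub>m (\<nu> \<otimes>\<^sub>m \<nu>) \<cdot> q"
    "Id V \<otimes>\<^sub>m \<nu> = \<pi> \<otimes>\<^sub>m \<nu> +\<^sub>m (\<nu> \<otimes>\<^sub>m \<nu>) \<cdot> q"
    by (simp_all only: split) (simp_all add: tens_add point_tens_comp flip: tens_point_comp)
  have "\<sigma> \<cdot> \<Delta> = Id V \<otimes>\<^sub>m \<nu> +\<^sub>m \<nu> \<otimes>\<^sub>m \<pi>"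
    by (simp add: \<Delta>_def comp_add nat nat_pi)
  also have "\<dots> = \<Delta>"
    by (simp add: \<Delta>_def sym add_ac)
  finally show "cocommutative C \<sigma> \<Delta>"
    by (simp add: cocommutative_def)
qed

end

section \<open>The braiding of a Leibniz algebra\<close>

context unital_leibniz_algebra
begin

lemma leibniz_typing [simp]:
  "V \<in> obj C"
  "\<beta> \<in> arr C" "src C \<beta> = V \<otimes>\<^sub>o V" "trg C \<beta> = V"
  "\<nu> \<in> arr C" "src C \<nu> = \<I>" "trg C \<nu> = V"
  using V_obj bracket_mor unit_mor by (simp_all add: mor_iff)

lemma sigma_Lei_typing [simp]:
  "sigma_Lei C c V \<beta> \<nu> \<in> arr C"
  "src C (sigma_Lei C c V \<beta> \<nu>) = V \<otimes>\<^sub>o V"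
  "trg C (sigma_Lei C c V \<beta> \<nu>) = V \<otimes>\<^sub>o V"
  by (simp_all add: sigma_Lei_def)

lemma bracket_unit:
  assumes "f \<in> arr C" "trg C f = V"
  shows "\<beta> \<cdot> (f \<otimes>\<^sub>m \<nu>) = \<zero>\<^sub>m (src C f) V" "\<beta> \<cdot> (\<nu> \<otimes>\<^sub>m f) = \<zero>\<^sub>m (src C f) V"
proof -
  have "f \<otimes>\<^sub>m \<nu> = (Id V \<otimes>\<^sub>m \<nu>) \<cdot> f" "\<nu> \<otimes>\<^sub>m f = (\<nu> \<otimes>\<^sub>m Id V) \<cdot> f"
    using assms by (simp_all add: tens_point_comp point_tens_comp)
  then have "\<beta> \<cdot> (f \<otimes>\<^sub>m \<nu>) = (\<beta> \<cdot> (Id V \<otimes>\<^sub>m \<nu>)) \<cdot> f" "\<beta> \<cdot> (\<nu> \<otimes>\<^sub>m f) = (\<beta> \<cdot> (\<nu> \<otimes>\<^sub>m Id V)) \<cdot> f"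
    using assms by (simp_all add: assoc_comp)
  then show "\<beta> \<cdot> (f \<otimes>\<^sub>m \<nu>) = \<zero>\<^sub>m (src C f) V" "\<beta> \<cdot> (\<nu> \<otimes>\<^sub>m f) = \<zero>\<^sub>m (src C f) V"
    using assms by (simp_all add: bracket_unit_right bracket_unit_left)
qed

lemma leibniz_sum:
  "\<beta> \<cdot> (\<beta> \<otimes>\<^sub>m Id V) = \<beta> \<cdot> (Id V \<otimes>\<^sub>m \<beta>) +\<^sub>m \<beta> \<cdot> (\<beta> \<otimes>\<^sub>m Id V) \<cdot> (Id V \<otimes>\<^sub>m c V V)"
  by (simp add: leibniz)

lemma sigma_Lei_point:
  assumes "f \<in> arr C" "trg C f = V"
  shows "sigma_Lei C c V \<beta> \<nu> \<cdot> (f \<otimes>\<^sub>m \<nu>) = \<nu> \<otimes>\<^sub>m f"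
    and "sigma_Lei C c V \<beta> \<nu> \<cdot> (\<nu> \<otimes>\<^sub>m f) = f \<otimes>\<^sub>m \<nu>"
  using assms
  by (simp_all add: sigma_Lei_def comp_add braid_points point_tens_comp bracket_unit)

lemma natural_Lei: "natural_wrt C V (sigma_Lei C c V \<beta> \<nu>) \<nu>"
  by (simp add: natural_wrt_def demi_natural_def unit_mor sigma_Lei_point)

text \<open>The terms with one bracket send \<open>(a, b, c)\<close> to \<open>(c, 1, [a, b])\<close>, \<open>(1, b, [a, c])\<close> and
  \<open>(1, [b, c], a)\<close>, on either side. The composites \<open>b\<^sub>1 b\<^sub>2\<close> and \<open>b\<^sub>1 c\<^sub>2 b\<^sub>1\<close> vanish, because the
  factor applied last brackets with the unit that the first one has created.\<close>

theorem pre_braided_Lei: "pre_braided_object C V (sigma_Lei C c V \<beta> \<nu>)"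
proof
  let ?X = "V \<otimes>\<^sub>o V \<otimes>\<^sub>o V"
  let ?c1 = "c V V \<otimes>\<^sub>m Id V" and ?c2 = "Id V \<otimes>\<^sub>m c V V"
  let ?b1 = "\<nu> \<otimes>\<^sub>m \<beta> \<otimes>\<^sub>m Id V" and ?b2 = "Id V \<otimes>\<^sub>m \<nu> \<otimes>\<^sub>m \<beta>"
  have c12: "?c1 \<cdot> ?c2 = c (V \<otimes>\<^sub>o V) V" and c21: "?c2 \<cdot> ?c1 = c V (V \<otimes>\<^sub>o V)"
    by (simp_all add: braid_hexagon_left braid_hexagon)
  have c1b2: "?c1 \<cdot> ?b2 = \<nu> \<otimes>\<^sub>m Id V \<otimes>\<^sub>m \<beta>"
    by (simp add: interchange_cut_after_two braid_points)
  have c2b1: "?c2 \<cdot> ?b1 = (\<nu> \<otimes>\<^sub>m Id V \<otimes>\<^sub>m \<beta>) \<cdot> ?c1 \<cdot> ?c2"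
    by (simp add: c12 interchange braid_tens point_tens_comp)
  have b1b2: "?b1 \<cdot> ?b2 = \<zero>\<^sub>m ?X ?X"
    by (simp add: point_tens_comp interchange_cut_after_two bracket_unit)
  have b1\<nu>: "?b1 \<cdot> (\<nu> \<otimes>\<^sub>m Id V \<otimes>\<^sub>m \<beta>) = \<zero>\<^sub>m ?X ?X"
    by (simp add: point_tens_comp interchange_cut_after_two bracket_unit)
  have c22: "?c2 \<cdot> ?c2 = Id ?X"
    by (simp add: interchange braid_symmetric)
  have ccb: "?c1 \<cdot> ?c2 \<cdot> ?b1 = ?b2 \<cdot> ?c1 \<cdot> ?c2"
  proof -
    have "c (V \<otimes>\<^sub>o V) V \<cdot> ((\<nu> \<otimes>\<^sub>m \<beta>) \<otimes>\<^sub>m Id V) = (Id V \<otimes>\<^sub>m (\<nu> \<otimes>\<^sub>m \<beta>)) \<cdot> c (V \<otimes>\<^sub>o V) V"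
      by (simp add: braid_tens del: tens_mor_simps)
    then show ?thesis
      by (simp add: c12 flip: assoc_comp)
  qed
  have bcc: "?b1 \<cdot> ?c2 \<cdot> ?c1 = ?c2 \<cdot> ?c1 \<cdot> ?b2"
  proof -
    have "c V (V \<otimes>\<^sub>o V) \<cdot> (Id V \<otimes>\<^sub>m (\<nu> \<otimes>\<^sub>m \<beta>)) = ((\<nu> \<otimes>\<^sub>m \<beta>) \<otimes>\<^sub>m Id V) \<cdot> c V (V \<otimes>\<^sub>o V)"
      by (simp add: braid_tens del: tens_mor_simps)
    then show ?thesis
      by (simp add: c21 flip: assoc_comp)
  qed
  (* Both sides send (a, b, c) to (1, b, [a, c]); on the right two crossings cancel. *)
  have cbc: "?c1 \<cdot> ?b2 \<cdot> ?c1 = ?c2 \<cdot> ?b1 \<cdot> ?c2"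
  proof -
    have "?c1 \<cdot> ?b2 \<cdot> ?c1 = (\<nu> \<otimes>\<^sub>m Id V \<otimes>\<^sub>m \<beta>) \<cdot> ?c1"
      using assoc_comp[of ?c1 ?b2 ?c1] c1b2 by simp
    also have "\<dots> = (\<nu> \<otimes>\<^sub>m Id V \<otimes>\<^sub>m \<beta>) \<cdot> ?c1 \<cdot> (?c2 \<cdot> ?c2)"
      by (simp add: c22)
    also have "\<dots> = (?c2 \<cdot> ?b1) \<cdot> ?c2"
      unfolding c2b1 by (simp add: assoc_comp)
    also have "\<dots> = ?c2 \<cdot> ?b1 \<cdot> ?c2"
      by (simp add: assoc_comp)
    finally show ?thesis .
  qed
  (* The three terms are \<nu> \<otimes> \<nu> followed by the three terms of the Leibniz identity. *)
  have cbb: "?c1 \<cdot> ?b2 \<cdot> ?b1 = ?b2 \<cdot> ?c1 \<cdot> ?b2 +\<^sub>m ?b2 \<cdot> ?b1 \<cdot> ?c2"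
  proof -
    have "?c1 \<cdot> ?b2 \<cdot> ?b1 = (\<nu> \<otimes>\<^sub>m Id V \<otimes>\<^sub>m \<beta>) \<cdot> ?b1"
      using assoc_comp[of ?b1 ?b2 ?c1] c1b2 by simp
    also have "\<dots> = \<nu> \<otimes>\<^sub>m \<nu> \<otimes>\<^sub>m (\<beta> \<cdot> (\<beta> \<otimes>\<^sub>m Id V))"
      by (simp add: tens_calculus)
    also have "\<dots> = \<nu> \<otimes>\<^sub>m \<nu> \<otimes>\<^sub>m (\<beta> \<cdot> (Id V \<otimes>\<^sub>m \<beta>))
        +\<^sub>m \<nu> \<otimes>\<^sub>m \<nu> \<otimes>\<^sub>m (\<beta> \<cdot> (\<beta> \<otimes>\<^sub>m Id V) \<cdot> (Id V \<otimes>\<^sub>m c V V))"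
      by (subst leibniz_sum) (simp add: tens_add)
    also have "\<nu> \<otimes>\<^sub>m \<nu> \<otimes>\<^sub>m (\<beta> \<cdot> (Id V \<otimes>\<^sub>m \<beta>)) = ?b2 \<cdot> ?c1 \<cdot> ?b2"
      unfolding c1b2 by (simp add: tens_calculus)
    also have "\<nu> \<otimes>\<^sub>m \<nu> \<otimes>\<^sub>m (\<beta> \<cdot> (\<beta> \<otimes>\<^sub>m Id V) \<cdot> (Id V \<otimes>\<^sub>m c V V)) = ?b2 \<cdot> ?b1 \<cdot> ?c2"
      by (simp add: point_tens_comp interchange)
    finally show ?thesis .
  qed
  have bcb: "?b1 \<cdot> ?c2 \<cdot> ?b1 = \<zero>\<^sub>m ?X ?X"
  proof -
    have "?b1 \<cdot> ?c2 \<cdot> ?b1 = (?b1 \<cdot> (\<nu> \<otimes>\<^sub>m Id V \<otimes>\<^sub>m \<beta>)) \<cdot> ?c1 \<cdot> ?c2"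
      unfolding c2b1 by (simp add: assoc_comp)
    then show ?thesis
      by (simp add: b1\<nu>)
  qed
  have strands: "strand V 1 (sigma_Lei C c V \<beta> \<nu>) 1 = ?c1 +\<^sub>m ?b1"
    "strand V 2 (sigma_Lei C c V \<beta> \<nu>) 0 = ?c2 +\<^sub>m ?b2"
    by (simp_all add: sigma_Lei_def strand_simps tens_add del: One_nat_def)
  show "strand V 1 (sigma_Lei C c V \<beta> \<nu>) 1 \<cdot> strand V 2 (sigma_Lei C c V \<beta> \<nu>) 0
      \<cdot> strand V 1 (sigma_Lei C c V \<beta> \<nu>) 1
    = strand V 2 (sigma_Lei C c V \<beta> \<nu>) 0 \<cdot> strand V 1 (sigma_Lei C c V \<beta> \<nu>) 1
      \<cdot> strand V 2 (sigma_Lei C c V \<beta> \<nu>) 0"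
    unfolding strands
    by (rule yang_baxter_sum[where X = ?X, OF _ _ _ _ braid_yang_baxter ccb cbc bcc cbb b1b2 bcb])
      (simp_all add: mor_iff)
qed (simp_all add: mor_iff)

text \<open>The inverse is \<open>(a, b) \<mapsto> (b, a) - ([b, a], 1)\<close>: applied to \<open>(b, a)\<close>, the braiding leaves the
  error term \<open>(1, [b, a])\<close>, which is its value at \<open>([b, a], 1)\<close>.\<close>

theorem invertible_Lei: "invertible (V \<otimes>\<^sub>o V) (V \<otimes>\<^sub>o V) (sigma_Lei C c V \<beta> \<nu>)"
proof -
  let ?\<sigma> = "sigma_Lei C c V \<beta> \<nu>" and ?w = "(\<beta> \<cdot> c V V) \<otimes>\<^sub>m \<nu>"
  let ?\<tau> = "c V V -\<^sub>m ?w"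
  have sum: "?\<tau> +\<^sub>m ?w = c V V"
    by simp
  have cc: "c V V \<cdot> c V V = Id (V \<otimes>\<^sub>o V)"
    by (simp add: braid_symmetric)
  have "?\<sigma> \<cdot> (?\<tau> +\<^sub>m ?w) = ?\<sigma> \<cdot> ?\<tau> +\<^sub>m ?\<sigma> \<cdot> ?w"
    by (rule comp_add(1)) simp_all
  then have "?\<sigma> \<cdot> ?\<tau> +\<^sub>m ?\<sigma> \<cdot> ?w = ?\<sigma> \<cdot> c V V"
    by (simp only: sum)
  also have "\<dots> = Id (V \<otimes>\<^sub>o V) +\<^sub>m ?\<sigma> \<cdot> ?w"
    by (simp add: sigma_Lei_point) (simp add: sigma_Lei_def comp_add cc point_tens_comp)
  finally have right: "?\<sigma> \<cdot> ?\<tau> = Id (V \<otimes>\<^sub>o V)"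
    by (simp add: add_right_cancel)
  have "\<beta> \<cdot> c V V \<cdot> ?\<sigma> = \<beta>"
    by (simp add: sigma_Lei_def comp_add cc braid_points bracket_unit)
  then have w: "?w \<cdot> ?\<sigma> = \<beta> \<otimes>\<^sub>m \<nu>"
    by (simp add: tens_point_comp assoc_comp)
  have "(?\<tau> +\<^sub>m ?w) \<cdot> ?\<sigma> = ?\<tau> \<cdot> ?\<sigma> +\<^sub>m ?w \<cdot> ?\<sigma>"
    by (rule comp_add(2)) simp_all
  then have "?\<tau> \<cdot> ?\<sigma> +\<^sub>m ?w \<cdot> ?\<sigma> = c V V \<cdot> ?\<sigma>"
    by (simp only: sum)
  also have "\<dots> = Id (V \<otimes>\<^sub>o V) +\<^sub>m ?w \<cdot> ?\<sigma>"
    by (simp add: w) (simp add: sigma_Lei_def comp_add cc braid_points)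
  finally have left: "?\<tau> \<cdot> ?\<sigma> = Id (V \<otimes>\<^sub>o V)"
    by (simp add: add_right_cancel)
  show ?thesis
    unfolding invertible_def
    by (intro conjI bexI[of _ ?\<tau>] left right) (simp_all add: mor_iff)
qed

end

context leibniz_decomposition
begin

lemma decomposition_typing [simp]:
  "V' \<in> obj C" "i \<in> arr C" "src C i = V'" "trg C i = V"
  "p \<in> arr C" "src C p = V" "trg C p = V'" "q \<in> arr C" "src C q = V" "trg C q = \<I>"
  using decomposition by (simp_all add: biproduct_def mor_iff)

lemma decomposition_simps:
  "p \<cdot> i = Id V'" "q \<cdot> \<nu> = Id \<I>" "p \<cdot> \<nu> = \<zero>\<^sub>m \<I> V'" "q \<cdot> i = \<zero>\<^sub>m V' \<I>"
  "i \<cdot> p +\<^sub>m \<nu> \<cdot> q = Id V"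
  using decomposition by (simp_all add: biproduct_def)

text \<open>The bracket sees only the \<open>V'\<close>-components of its arguments, because it vanishes on the unit;
  its values lie in \<open>V'\<close>, because it restricts to \<open>V'\<close>.\<close>

lemma bracket_proj:
  shows "\<beta> \<cdot> ((i \<cdot> p) \<otimes>\<^sub>m Id V) = \<beta>" and "(i \<cdot> p) \<cdot> \<beta> = \<beta>"
proof -
  let ?\<pi> = "i \<cdot> p"
  have \<nu>q: "(\<nu> \<cdot> q) \<otimes>\<^sub>m f = \<nu> \<otimes>\<^sub>m (q \<otimes>\<^sub>m f)" "f \<otimes>\<^sub>m (\<nu> \<cdot> q) = (f \<otimes>\<^sub>m q) \<otimes>\<^sub>m \<nu>"
    if "f \<in> arr C" for f
    using interchange[of q \<nu> f "Id (trg C f)"] interchange[of f "Id (trg C f)" q \<nu>]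
      point_tens_comp[of \<nu> "Id (trg C f)" "q \<otimes>\<^sub>m f"]
      tens_point_comp[of \<nu> "Id (trg C f)" "f \<otimes>\<^sub>m q"] that
    by simp_all
  have "\<beta> \<cdot> (?\<pi> \<otimes>\<^sub>m Id V +\<^sub>m (\<nu> \<cdot> q) \<otimes>\<^sub>m Id V) = \<beta>"
    by (simp add: decomposition_simps flip: tens_add)
  then show left: "\<beta> \<cdot> (?\<pi> \<otimes>\<^sub>m Id V) = \<beta>"
    by (simp add: comp_add \<nu>q bracket_unit)
  have "\<beta> \<cdot> (Id V \<otimes>\<^sub>m ?\<pi> +\<^sub>m Id V \<otimes>\<^sub>m (\<nu> \<cdot> q)) = \<beta>"
    by (simp add: decomposition_simps flip: tens_add)
  then have right: "\<beta> \<cdot> (Id V \<otimes>\<^sub>m ?\<pi>) = \<beta>"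
    using bracket_unit(1)[of "Id V \<otimes>\<^sub>m q"] by (simp add: comp_add \<nu>q)
  obtain \<beta>' where \<beta>': "leibniz_algebra C c V' \<beta>'" "\<beta> \<cdot> (i \<otimes>\<^sub>m i) = i \<cdot> \<beta>'"
    using bracket_restricts by blast
  have [simp]: "\<beta>' \<in> arr C" "src C \<beta>' = V' \<otimes>\<^sub>o V'" "trg C \<beta>' = V'"
    using leibniz_algebra.bracket_mor[OF \<beta>'(1)] by (simp_all add: mor_iff)
  have "\<beta> = (\<beta> \<cdot> (?\<pi> \<otimes>\<^sub>m Id V)) \<cdot> (Id V \<otimes>\<^sub>m ?\<pi>)"
    by (simp only: left right)
  also have "\<dots> = \<beta> \<cdot> (i \<otimes>\<^sub>m i) \<cdot> (p \<otimes>\<^sub>m p)"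
    by (simp add: assoc_comp interchange)
  also have "\<dots> = (\<beta> \<cdot> (i \<otimes>\<^sub>m i)) \<cdot> (p \<otimes>\<^sub>m p)"
    by (simp add: assoc_comp)
  also have "\<dots> = i \<cdot> \<beta>' \<cdot> (p \<otimes>\<^sub>m p)"
    by (simp add: \<beta>' assoc_comp)
  finally have \<beta>: "\<beta> = i \<cdot> \<beta>' \<cdot> (p \<otimes>\<^sub>m p)" .
  have "?\<pi> \<cdot> i \<cdot> \<beta>' \<cdot> (p \<otimes>\<^sub>m p) = i \<cdot> (p \<cdot> i) \<cdot> \<beta>' \<cdot> (p \<otimes>\<^sub>m p)"
    by (simp add: assoc_comp)
  then show "?\<pi> \<cdot> \<beta> = \<beta>"
    unfolding \<beta>[symmetric] by (simp add: decomposition_simps flip: \<beta>)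
qed

text \<open>An arrow out of \<open>V\<close> is determined by its restrictions \<open>f\<close> along \<open>i\<close> and \<open>g\<close> along \<open>\<nu>\<close>, as
  \<open>f \<cdot> p + g \<cdot> q\<close>.\<close>

lemma is_Delta_Lei_iff:
  "is_Delta_Lei C V \<nu> i \<Delta> \<longleftrightarrow> \<Delta> = \<nu> \<otimes>\<^sub>m Id V +\<^sub>m (i \<cdot> p) \<otimes>\<^sub>m \<nu>"
proof
  assume *: "is_Delta_Lei C V \<nu> i \<Delta>"
  then have [simp]: "\<Delta> \<in> arr C" "src C \<Delta> = V" "trg C \<Delta> = V \<otimes>\<^sub>o V"
    by (simp_all add: is_Delta_Lei_def mor_iff)
  have "\<Delta> = \<Delta> \<cdot> (i \<cdot> p +\<^sub>m \<nu> \<cdot> q)"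
    by (simp add: decomposition_simps)
  also have "\<dots> = (\<Delta> \<cdot> i) \<cdot> p +\<^sub>m (\<Delta> \<cdot> \<nu>) \<cdot> q"
    by (simp add: comp_add assoc_comp)
  also have "\<dots> = (\<nu> \<otimes>\<^sub>m i +\<^sub>m i \<otimes>\<^sub>m \<nu>) \<cdot> p +\<^sub>m (\<nu> \<otimes>\<^sub>m \<nu>) \<cdot> q"
    using * by (simp add: is_Delta_Lei_def)
  also have "\<dots> = \<nu> \<otimes>\<^sub>m (i \<cdot> p +\<^sub>m \<nu> \<cdot> q) +\<^sub>m (i \<cdot> p) \<otimes>\<^sub>m \<nu>"
    by (simp add: comp_add tens_add add_ac point_tens_comp[of \<nu>] tens_point_comp[of \<nu> i])
  finally show "\<Delta> = \<nu> \<otimes>\<^sub>m Id V +\<^sub>m (i \<cdot> p) \<otimes>\<^sub>m \<nu>"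
    by (simp add: decomposition_simps)
next
  assume \<Delta>: "\<Delta> = \<nu> \<otimes>\<^sub>m Id V +\<^sub>m (i \<cdot> p) \<otimes>\<^sub>m \<nu>"
  show "is_Delta_Lei C V \<nu> i \<Delta>"
    by (simp add: is_Delta_Lei_def \<Delta> mor_iff comp_add point_tens_comp tens_point_comp
        assoc_comp decomposition_simps)
qed

theorem coalgebra_Lei:
  assumes "is_Delta_Lei C V \<nu> i \<Delta>"
  shows "semi_pre_braided_coalgebra C V (sigma_Lei C c V \<beta> \<nu>) \<Delta>"
    and "cocommutative C (sigma_Lei C c V \<beta> \<nu>) \<Delta>"
proof -
  let ?\<pi> = "i \<cdot> p" and ?\<sigma> = "sigma_Lei C c V \<beta> \<nu>"
  have "(Id V \<otimes>\<^sub>m ?\<pi>) \<cdot> ?\<sigma> = (Id V \<otimes>\<^sub>m ?\<pi>) \<cdot> c V V +\<^sub>m \<nu> \<otimes>\<^sub>m \<beta>"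
    using bracket_proj(2) by (simp add: sigma_Lei_def comp_add interchange[of \<nu>])
  also have "\<dots> = ?\<sigma> \<cdot> (?\<pi> \<otimes>\<^sub>m Id V)"
    using bracket_proj(1) by (simp add: sigma_Lei_def comp_add braid_tens point_tens_comp)
  finally have slide: "(Id V \<otimes>\<^sub>m ?\<pi>) \<cdot> ?\<sigma> = ?\<sigma> \<cdot> (?\<pi> \<otimes>\<^sub>m Id V)" .
  have proj: "?\<pi> \<in> mor C V V" "q \<in> mor C V \<I>" "Id V = ?\<pi> +\<^sub>m \<nu> \<cdot> q" "?\<pi> \<cdot> \<nu> = \<zero>\<^sub>m \<I> V"
    by (simp_all add: mor_iff assoc_comp decomposition_simps)
  have \<Delta>: "\<Delta> = \<nu> \<otimes>\<^sub>m Id V +\<^sub>m ?\<pi> \<otimes>\<^sub>m \<nu>"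
    using assms by (simp only: is_Delta_Lei_iff)
  show "semi_pre_braided_coalgebra C V ?\<sigma> \<Delta>" "cocommutative C ?\<sigma> \<Delta>"
    unfolding \<Delta> by (rule primitive_coalgebra[OF pre_braided_Lei natural_Lei proj slide])+
qed

end

context lie_character
begin

theorem braided_character_Lei: "braided_character C V (sigma_Lei C c V \<beta> \<nu>) \<epsilon>"
proof -
  interpret pre_braided_object C V "sigma_Lei C c V \<beta> \<nu>"
    by (rule pre_braided_Lei)
  have [simp]: "\<epsilon> \<in> arr C" "src C \<epsilon> = V" "trg C \<epsilon> = \<I>"
    using char_mor by (simp_all add: mor_iff)
  have "(\<epsilon> \<otimes>\<^sub>m \<epsilon>) \<cdot> c V V = \<epsilon> \<otimes>\<^sub>m \<epsilon>"
    using braid_tens[of \<epsilon> \<epsilon>] by simp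
  then have "(\<epsilon> \<otimes>\<^sub>m \<epsilon>) \<cdot> sigma_Lei C c V \<beta> \<nu> = \<epsilon> \<otimes>\<^sub>m \<epsilon>"
    by (simp add: sigma_Lei_def comp_add interchange char_bracket char_unit)
  then show ?thesis
    by unfold_locales (simp_all add: char_mor)
qed

lemma normalized_Lei: "normalized_pair C V \<nu> \<epsilon>"
  by (simp add: normalized_pair_def unit_mor char_mor char_unit)

end

section \<open>Both braidings\<close>

theorem theorem6:
  fixes C :: "('o, 'm, 'x) monoidal_category_scheme" and V :: 'o and \<mu> \<nu> :: 'm
    and D :: "('p, 'n, 'y) preadditive_monoidal_category_scheme"
    and c :: "'p \<Rightarrow> 'p \<Rightarrow> 'n" and W :: 'p and \<beta> \<eta> :: 'n
  shows
    "(strict_monoidal_category C \<and> right_unital_algebra C V \<mu> \<nu> \<longrightarrow>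
        pre_braided_object C V (sigma_Ass C \<mu> \<nu>) \<and>
        (unital_algebra C V \<mu> \<nu> \<longrightarrow>
           pre_braided_coalgebra C V (sigma_Ass C \<mu> \<nu>) (Delta_Ass C V \<nu>) \<and>
           cocommutative C (sigma_Ass C \<mu> \<nu>) (Delta_Ass C V \<nu>)) \<and>
        (\<forall>\<epsilon>. algebra_character C V \<mu> \<nu> \<epsilon> \<longrightarrow>
           braided_character C V (sigma_Ass C \<mu> \<nu>) \<epsilon>) \<and>
        demi_natural C V (sigma_Ass C \<mu> \<nu>) \<nu> \<and>
        (\<forall>\<epsilon>. algebra_character C V \<mu> \<nu> \<epsilon> \<longrightarrow> normalized_pair C V \<nu> \<epsilon>)) \<and>
     (symmetric_preadditive_strict_monoidal_category D c \<and>
      unital_leibniz_algebra D c W \<beta> \<eta> \<longrightarrow>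
        pre_braided_object D W (sigma_Lei D c W \<beta> \<eta>) \<and>
        category.invertible D (W \<otimes>\<^sub>o\<^bsub>D\<^esub> W) (W \<otimes>\<^sub>o\<^bsub>D\<^esub> W) (sigma_Lei D c W \<beta> \<eta>) \<and>
        (\<forall>W' i p q. additive_category D \<and> leibniz_decomposition D c W \<beta> \<eta> W' i p q \<longrightarrow>
           (\<exists>!\<Delta>. is_Delta_Lei D W \<eta> i \<Delta>) \<and>
           (\<forall>\<Delta>. is_Delta_Lei D W \<eta> i \<Delta> \<longrightarrow>
              semi_pre_braided_coalgebra D W (sigma_Lei D c W \<beta> \<eta>) \<Delta> \<and>
              cocommutative D (sigma_Lei D c W \<beta> \<eta>) \<Delta>)) \<and>
        (\<forall>\<epsilon>. lie_character D c W \<beta> \<eta> \<epsilon> \<longrightarrow>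
           braided_character D W (sigma_Lei D c W \<beta> \<eta>) \<epsilon>) \<and>
        natural_wrt D W (sigma_Lei D c W \<beta> \<eta>) \<eta> \<and>
        (\<forall>\<epsilon>. lie_character D c W \<beta> \<eta> \<epsilon> \<longrightarrow> normalized_pair D W \<eta> \<epsilon>))"
proof (rule conjI; intro impI; elim conjE)
  assume "right_unital_algebra C V \<mu> \<nu>"
  then interpret right_unital_algebra C V \<mu> \<nu> .
  show "pre_braided_object C V (sigma_Ass C \<mu> \<nu>) \<and>
    (unital_algebra C V \<mu> \<nu> \<longrightarrow>
       pre_braided_coalgebra C V (sigma_Ass C \<mu> \<nu>) (Delta_Ass C V \<nu>) \<and>
       cocommutative C (sigma_Ass C \<mu> \<nu>) (Delta_Ass C V \<nu>)) \<and>
    (\<forall>\<epsilon>. algebra_character C V \<mu> \<nu> \<epsilon> \<longrightarrow>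
       braided_character C V (sigma_Ass C \<mu> \<nu>) \<epsilon>) \<and>
    demi_natural C V (sigma_Ass C \<mu> \<nu>) \<nu> \<and>
    (\<forall>\<epsilon>. algebra_character C V \<mu> \<nu> \<epsilon> \<longrightarrow> normalized_pair C V \<nu> \<epsilon>)"
    by (intro conjI impI allI pre_braided_Ass demi_natural_Ass
        unital_algebra.pre_braided_coalgebra_Ass unital_algebra.cocommutative_Ass
        algebra_character.braided_character_Ass algebra_character.normalized_Ass)
next
  assume "unital_leibniz_algebra D c W \<beta> \<eta>"
  then interpret unital_leibniz_algebra D c W \<beta> \<eta> .
  show "pre_braided_object D W (sigma_Lei D c W \<beta> \<eta>) \<and>
    invertible (W \<otimes>\<^sub>o\<^bsub>D\<^esub> W) (W \<otimes>\<^sub>o\<^bsub>D\<^esub> W) (sigma_Lei D c W \<beta> \<eta>) \<and>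
    (\<forall>W' i p q. additive_category D \<and> leibniz_decomposition D c W \<beta> \<eta> W' i p q \<longrightarrow>
       (\<exists>!\<Delta>. is_Delta_Lei D W \<eta> i \<Delta>) \<and>
       (\<forall>\<Delta>. is_Delta_Lei D W \<eta> i \<Delta> \<longrightarrow>
          semi_pre_braided_coalgebra D W (sigma_Lei D c W \<beta> \<eta>) \<Delta> \<and>
          cocommutative D (sigma_Lei D c W \<beta> \<eta>) \<Delta>)) \<and>
    (\<forall>\<epsilon>. lie_character D c W \<beta> \<eta> \<epsilon> \<longrightarrow>
       braided_character D W (sigma_Lei D c W \<beta> \<eta>) \<epsilon>) \<and>
    natural_wrt D W (sigma_Lei D c W \<beta> \<eta>) \<eta> \<and>
    (\<forall>\<epsilon>. lie_character D c W \<beta> \<eta> \<epsilon> \<longrightarrow> normalized_pair D W \<eta> \<epsilon>)"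
    by (auto intro!: pre_braided_Lei invertible_Lei natural_Lei
        leibniz_decomposition.coalgebra_Lei lie_character.braided_character_Lei
        lie_character.normalized_Lei simp: leibniz_decomposition.is_Delta_Lei_iff)
qed

end
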